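(* Let $(M^n,g,V,\lambda,\beta)$, $n\ge4$, be an almost $\omega$-Bach soliton, where $\omega$ is the $1$-form associated to a vector field $P$, and suppose the potential vector field $V$ is a projective vector field with associated projective factor $\varphi=\frac{1}{n+1}\operatorname{div}V$. Then the $\omega$-Bach tensor is divergence free if and only if $$\nabla\varphi=-\frac{2\beta}{n^2+n-2}\nabla|P|^2 .$$ In this case, $X\lambda=-\frac{n+3}{n^2+n-2}\,\beta\,X(|P|^2)$ for all vector fields $X$ on $M$.
   Context: $S$ denotes the Ricci tensor and $W$ the Weyl tensor, $W=R-\frac{2}{n-2}S\odot g+\frac{r}{(n-1)(n-2)}g\odot g$ ($\odot$ is the Kulkarni-Nomizu product, normalized so that $W$ is the trace-free part of the curvature tensor $R$; $r$ is the scalar curvature). The Bach tensor is the symmetric trace-free $(0,2)$ tensor $$B(X,Y)=\frac{1}{n-3}\sum_{i,j}(\nabla_{e_i}\nabla_{e_j}W)(X,e_i,e_j,Y)+\frac{1}{n-2}\sum_{i,j}S(e_i,e_j)W(X,e_i,e_j,Y),$$ with $\{e_i\}$ a local orthonormal frame. Given a vector field $P$ with associated $1$-form $\omega(X)=g(X,P)$ and $\beta\in\mathbb{R}$, the $\omega$-Bach tensor is $B_\omega=B-\beta\,\omega\otimes\omega$. $(M^n,g,V,\lambda,\beta)$ is an almost $\omega$-Bach soliton with potential vector field $V$ if $\frac12\mathfrak{L}_Vg+B_\omega=\lambda g$ with $\lambda\in C^\infty(M)$. A vector field $V$ is projective if $(\mathfrak{L}_V\nabla)(X,Y)=\rho(X)Y+\rho(Y)X$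 for some $1$-form $\rho$ ($\nabla$ the Levi-Civita connection); in that case $(\mathfrak{L}_V\nabla)(X,Y)=(X\varphi)Y+(Y\varphi)X$ with $\varphi=\frac{\operatorname{div}V}{n+1}$, called the projective factor of $V$. The divergence of a symmetric $(0,2)$ tensor $T$ is $(\operatorname{div}T)(Z)=\sum_i(\nabla_{e_i}T)(e_i,Z)$. *)

theory Defs
  imports "HOL-Analysis.Analysis"
begin

section \<open>Smooth manifolds and tensor fields\<close>

text \<open>The (Frechet) derivative of \<open>f\<close> at \<open>x\<close> in the direction \<open>v\<close>. For a vector field \<open>X\<close> in a
  chart, the function \<open>X f\<close> is \<open>\<lambda>x. dd f x (X x)\<close>.\<close>

definition dd :: "('a::euclidean_space \<Rightarrow> 'b::real_normed_vector) \<Rightarrow> 'a \<Rightarrow> 'a \<Rightarrow> 'b" where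
  "dd f x v = frechet_derivative f (at x) v"

primrec Ck_on :: "nat \<Rightarrow> 'a::euclidean_space set \<Rightarrow> ('a \<Rightarrow> 'b::real_normed_vector) \<Rightarrow> bool" where
  "Ck_on 0 S f \<longleftrightarrow> continuous_on S f"
| "Ck_on (Suc k) S f \<longleftrightarrow> f differentiable_on S \<and> (\<forall>v. Ck_on k S (\<lambda>x. dd f x v))"

text \<open>Only used for open sets \<open>S\<close>.\<close>

definition smooth_on :: "'a::euclidean_space set \<Rightarrow> ('a \<Rightarrow> 'b::real_normed_vector) \<Rightarrow> bool" where
  "smooth_on S f \<longleftrightarrow> (\<forall>k. Ck_on k S f)"

text \<open>A chart is a pair of its domain and a coordinate map, whose values outside of the domain are
  irrelevant. The manifold is the whole type \<open>'a\<close>, which is a second countable Hausdorff space; its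
  dimension is \<open>CARD('n)\<close>.\<close>

type_synonym ('a, 'n) chart = "'a set \<times> ('a \<Rightarrow> real ^ 'n)"

definition cdom :: "('a, 'n) chart \<Rightarrow> 'a set" where
  "cdom c = fst c"

definition cmap :: "('a, 'n) chart \<Rightarrow> 'a \<Rightarrow> real ^ 'n" where
  "cmap c = snd c"

definition cimg :: "('a, 'n) chart \<Rightarrow> (real ^ 'n) set" where
  "cimg c = cmap c ` cdom c"

definition cinv :: "('a, 'n) chart \<Rightarrow> real ^ 'n \<Rightarrow> 'a" where
  "cinv c = inv_into (cdom c) (cmap c)"

definition overlap :: "('a, 'n) chart \<Rightarrow> ('a, 'n) chart \<Rightarrow> (real ^ 'n) set" where
  "overlap c d = cmap c ` (cdom c \<inter> cdom d)"

definition transition :: "('a, 'n) chart \<Rightarrow> ('a, 'n) chart \<Rightarrow> real ^ 'n \<Rightarrow> real ^ 'n" where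
  "transition c d = cmap d \<circ> cinv c"

definition smooth_atlas ::
    "('a::{t2_space, second_countable_topology}, 'n::finite) chart set \<Rightarrow> bool" where
  "smooth_atlas A \<longleftrightarrow>
     (\<Union>c\<in>A. cdom c) = UNIV \<and>
     (\<forall>c\<in>A. open (cdom c) \<and> open (cimg c) \<and> homeomorphism (cdom c) (cimg c) (cmap c) (cinv c)) \<and>
     (\<forall>c\<in>A. \<forall>d\<in>A. smooth_on (overlap c d) (transition c d))"

definition smooth_function ::
    "('a::{t2_space, second_countable_topology}, 'n::finite) chart set \<Rightarrow> ('a \<Rightarrow> real) \<Rightarrow> bool" where
  "smooth_function A f \<longleftrightarrow> (\<forall>c\<in>A. smooth_on (cimg c) (f \<circ> cinv c))"

text \<open>A tensor field is the family of its coordinate expressions, one for each chart \<open>c\<close> of the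
  atlas, defined on the open set \<open>cimg c\<close> and related by the usual transformation law. Tangent
  vectors are written in the coordinate basis, that is as elements of \<open>real ^ 'n\<close>, and covariant
  tensors are multilinear maps of these.\<close>

definition vector_field ::
    "('a::{t2_space, second_countable_topology}, 'n::finite) chart set \<Rightarrow>
     (('a, 'n) chart \<Rightarrow> real ^ 'n \<Rightarrow> real ^ 'n) \<Rightarrow> bool" where
  "vector_field A V \<longleftrightarrow>
     (\<forall>c\<in>A. smooth_on (cimg c) (V c)) \<and>
     (\<forall>c\<in>A. \<forall>d\<in>A. \<forall>x\<in>overlap c d. V d (transition c d x) = dd (transition c d) x (V c x))"

definition one_form ::
    "('a::{t2_space, second_countable_topology}, 'n::finite) chart set \<Rightarrow>
     (('a, 'n) chart \<Rightarrow> real ^ 'n \<Rightarrow> real ^ 'n \<Rightarrow> real) \<Rightarrow> bool" where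
  "one_form A \<rho> \<longleftrightarrow>
     (\<forall>c\<in>A. \<forall>x\<in>cimg c. linear (\<rho> c x)) \<and>
     (\<forall>c\<in>A. \<forall>v. smooth_on (cimg c) (\<lambda>x. \<rho> c x v)) \<and>
     (\<forall>c\<in>A. \<forall>d\<in>A. \<forall>x\<in>overlap c d. \<forall>v.
        \<rho> c x v = \<rho> d (transition c d x) (dd (transition c d) x v))"

definition inner_form :: "('v::real_vector \<Rightarrow> 'v \<Rightarrow> real) \<Rightarrow> bool" where
  "inner_form h \<longleftrightarrow> bilinear h \<and> (\<forall>v w. h v w = h w v) \<and> (\<forall>v. v \<noteq> 0 \<longrightarrow> 0 < h v v)"

definition riemannian_metric ::
    "('a::{t2_space, second_countable_topology}, 'n::finite) chart set \<Rightarrow>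
     (('a, 'n) chart \<Rightarrow> real ^ 'n \<Rightarrow> real ^ 'n \<Rightarrow> real ^ 'n \<Rightarrow> real) \<Rightarrow> bool" where
  "riemannian_metric A g \<longleftrightarrow>
     (\<forall>c\<in>A. \<forall>x\<in>cimg c. inner_form (g c x)) \<and>
     (\<forall>c\<in>A. \<forall>v w. smooth_on (cimg c) (\<lambda>x. g c x v w)) \<and>
     (\<forall>c\<in>A. \<forall>d\<in>A. \<forall>x\<in>overlap c d. \<forall>v w.
        g c x v w = g d (transition c d x) (dd (transition c d) x v) (dd (transition c d) x w))"

section \<open>Riemannian geometry in a chart\<close>

text \<open>In this section \<open>G\<close> is the coordinate expression of a metric, and \<open>X, Y, \<dots>\<close> are either
  vector fields on the image of the chart or tangent vectors at a point. A tangent vector \<open>v\<close> extends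
  to the vector field \<open>\<lambda>_. v\<close> with constant components; such fields commute, and a tensor may be
  evaluated on \<open>v\<close> by means of this extension.\<close>

type_synonym 'n metric = "real ^ 'n \<Rightarrow> real ^ 'n \<Rightarrow> real ^ 'n \<Rightarrow> real"

definition lie_bracket ::
    "(real ^ 'n \<Rightarrow> real ^ 'n) \<Rightarrow> (real ^ 'n \<Rightarrow> real ^ 'n) \<Rightarrow> real ^ 'n::finite \<Rightarrow> real ^ 'n" where
  "lie_bracket X Y x = dd Y x (X x) - dd X x (Y x)"

text \<open>The Koszul formula for constant fields; the components of \<open>christoffel G x v w\<close> are
  \<open>\<Gamma>\<^sup>k\<^sub>i\<^sub>j v\<^sup>i w\<^sup>j\<close>.\<close>

definition christoffel :: "'n::finite metric \<Rightarrow> real ^ 'n \<Rightarrow> real ^ 'n \<Rightarrow> real ^ 'n \<Rightarrow> real ^ 'n" where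
  "christoffel G x v w = (THE u. \<forall>z.
     2 * G x u z = dd (\<lambda>y. G y w z) x v + dd (\<lambda>y. G y v z) x w - dd (\<lambda>y. G y v w) x z)"

definition nabla :: "'n::finite metric \<Rightarrow> (real ^ 'n \<Rightarrow> real ^ 'n) \<Rightarrow> (real ^ 'n \<Rightarrow> real ^ 'n)
    \<Rightarrow> real ^ 'n \<Rightarrow> real ^ 'n" where
  "nabla G X Y x = dd Y x (X x) + christoffel G x (X x) (Y x)"

text \<open>The covariant derivative of a covariant tensor \<open>T\<close> of rank \<open>k\<close>, with its arguments collected
  in a list of length \<open>k\<close>. The new argument, the direction of differentiation, comes first:
  \<open>covd G T x [v, w\<^sub>1, \<dots>, w\<^sub>k] = (\<nabla>\<^sub>v T)(w\<^sub>1, \<dots>, w\<^sub>k)\<close>.\<close>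

definition covd :: "'n::finite metric \<Rightarrow> (real ^ 'n \<Rightarrow> (real ^ 'n) list \<Rightarrow> real)
    \<Rightarrow> real ^ 'n \<Rightarrow> (real ^ 'n) list \<Rightarrow> real" where
  "covd G T x vs =
     (let v = hd vs; ws = tl vs in
      dd (\<lambda>y. T y ws) x v - (\<Sum>m<length ws. T x (ws[m := christoffel G x v (ws ! m)])))"

definition orthonormal_frame :: "('v \<Rightarrow> 'v \<Rightarrow> real) \<Rightarrow> ('n \<Rightarrow> 'v) \<Rightarrow> bool" where
  "orthonormal_frame h e \<longleftrightarrow> (\<forall>i j. h (e i) (e j) = (if i = j then 1 else 0))"

text \<open>An arbitrary orthonormal basis of the tangent space at \<open>x\<close>. By the lemmas
  \<open>orthonormal_frame_exists\<close> and \<open>orthonormal_frame_trace\<close> below, it exists, and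
  traces do not depend on the choice.\<close>

definition frame :: "'n::finite metric \<Rightarrow> real ^ 'n \<Rightarrow> 'n \<Rightarrow> real ^ 'n" where
  "frame G x = (SOME e. orthonormal_frame (G x) e)"

definition gradient :: "'n::finite metric \<Rightarrow> (real ^ 'n \<Rightarrow> real) \<Rightarrow> real ^ 'n \<Rightarrow> real ^ 'n" where
  "gradient G f x = (THE u. \<forall>z. G x u z = dd f x z)"

definition divergence :: "'n::finite metric \<Rightarrow> (real ^ 'n \<Rightarrow> real ^ 'n) \<Rightarrow> real ^ 'n \<Rightarrow> real" where
  "divergence G V x = (\<Sum>i\<in>UNIV. G x (nabla G (\<lambda>_. frame G x i) V x) (frame G x i))"

definition tensor_divergence :: "'n::finite metric \<Rightarrow>
    (real ^ 'n \<Rightarrow> real ^ 'n \<Rightarrow> real ^ 'n \<Rightarrow> real) \<Rightarrow> real ^ 'n \<Rightarrow> real ^ 'n \<Rightarrow> real" where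
  "tensor_divergence G T x Z =
     (\<Sum>i\<in>UNIV. covd G (\<lambda>y ws. T y (ws ! 0) (ws ! 1)) x [frame G x i, frame G x i, Z])"

definition curvature :: "'n::finite metric \<Rightarrow> (real ^ 'n \<Rightarrow> real ^ 'n) \<Rightarrow>
    (real ^ 'n \<Rightarrow> real ^ 'n) \<Rightarrow> (real ^ 'n \<Rightarrow> real ^ 'n) \<Rightarrow> real ^ 'n \<Rightarrow> real ^ 'n" where
  "curvature G X Y Z x =
     nabla G X (nabla G Y Z) x - nabla G Y (nabla G X Z) x - nabla G (lie_bracket X Y) Z x"

definition riemann :: "'n::finite metric \<Rightarrow> real ^ 'n \<Rightarrow>
    real ^ 'n \<Rightarrow> real ^ 'n \<Rightarrow> real ^ 'n \<Rightarrow> real ^ 'n \<Rightarrow> real" where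
  "riemann G x X Y Z U = G x (curvature G (\<lambda>_. X) (\<lambda>_. Y) (\<lambda>_. Z) x) U"

definition ricci :: "'n::finite metric \<Rightarrow> real ^ 'n \<Rightarrow> real ^ 'n \<Rightarrow> real ^ 'n \<Rightarrow> real" where
  "ricci G x X Y = (\<Sum>i\<in>UNIV. riemann G x (frame G x i) X Y (frame G x i))"

definition scalar_curvature :: "'n::finite metric \<Rightarrow> real ^ 'n \<Rightarrow> real" where
  "scalar_curvature G x = (\<Sum>i\<in>UNIV. ricci G x (frame G x i) (frame G x i))"

text \<open>The factor \<open>1 / 2\<close> and the order of the arguments are those for which constant sectional
  curvature \<open>K\<close> means \<open>R = K g \<odot> g\<close>, with \<open>R(X, Y, Y, X)\<close> the sectional curvature, and for which
  the Weyl tensor below is trace-free.\<close>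

definition kulkarni_nomizu :: "('v \<Rightarrow> 'v \<Rightarrow> real) \<Rightarrow> ('v \<Rightarrow> 'v \<Rightarrow> real) \<Rightarrow> 'v \<Rightarrow> 'v \<Rightarrow> 'v \<Rightarrow> 'v \<Rightarrow> real" where
  "kulkarni_nomizu h k X Y Z U =
     (h X U * k Y Z + h Y Z * k X U - h X Z * k Y U - h Y U * k X Z) / 2"

definition weyl :: "'n::finite metric \<Rightarrow> real ^ 'n \<Rightarrow>
    real ^ 'n \<Rightarrow> real ^ 'n \<Rightarrow> real ^ 'n \<Rightarrow> real ^ 'n \<Rightarrow> real" where
  "weyl G x X Y Z U =
     (let n = real CARD('n) in
      riemann G x X Y Z U
      - 2 / (n - 2) * kulkarni_nomizu (ricci G x) (G x) X Y Z U
      + scalar_curvature G x / ((n - 1) * (n - 2)) * kulkarni_nomizu (G x) (G x) X Y Z U)"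

definition bach :: "'n::finite metric \<Rightarrow> real ^ 'n \<Rightarrow> real ^ 'n \<Rightarrow> real ^ 'n \<Rightarrow> real" where
  "bach G x X Y =
     (let n = real CARD('n); e = frame G x;
          W = (\<lambda>y ws. weyl G y (ws ! 0) (ws ! 1) (ws ! 2) (ws ! 3)) in
      1 / (n - 3) * (\<Sum>i\<in>UNIV. \<Sum>j\<in>UNIV. covd G (covd G W) x [e i, e j, X, e i, e j, Y])
      + 1 / (n - 2) * (\<Sum>i\<in>UNIV. \<Sum>j\<in>UNIV. ricci G x (e i) (e j) * weyl G x X (e i) (e j) Y))"

definition dual_form ::
    "'n::finite metric \<Rightarrow> (real ^ 'n \<Rightarrow> real ^ 'n) \<Rightarrow> real ^ 'n \<Rightarrow> real ^ 'n \<Rightarrow> real" where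
  "dual_form G P x X = G x X (P x)"

definition norm_squared :: "'n::finite metric \<Rightarrow> (real ^ 'n \<Rightarrow> real ^ 'n) \<Rightarrow> real ^ 'n \<Rightarrow> real" where
  "norm_squared G P x = G x (P x) (P x)"

definition omega_bach :: "'n::finite metric \<Rightarrow> real \<Rightarrow> (real ^ 'n \<Rightarrow> real ^ 'n \<Rightarrow> real)
    \<Rightarrow> real ^ 'n \<Rightarrow> real ^ 'n \<Rightarrow> real ^ 'n \<Rightarrow> real" where
  "omega_bach G \<beta> \<omega> x X Y = bach G x X Y - \<beta> * (\<omega> x X * \<omega> x Y)"

text \<open>\<open>(\<LL>\<^sub>V g)(X, Y) = V(g(X, Y)) - g([V, X], Y) - g(X, [V, Y])\<close>.\<close>

definition lie_metric :: "(real ^ 'n::finite \<Rightarrow> real ^ 'n) \<Rightarrow> 'n metric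
    \<Rightarrow> real ^ 'n \<Rightarrow> real ^ 'n \<Rightarrow> real ^ 'n \<Rightarrow> real" where
  "lie_metric V G x X Y =
     dd (\<lambda>y. G y X Y) x (V x)
     - G x (lie_bracket V (\<lambda>_. X) x) Y - G x X (lie_bracket V (\<lambda>_. Y) x)"

text \<open>\<open>(\<LL>\<^sub>V \<nabla>)(X, Y) = [V, \<nabla>\<^sub>X Y] - \<nabla>\<^bsub>[V, X]\<^esub> Y - \<nabla>\<^sub>X [V, Y]\<close>.\<close>

definition lie_connection :: "(real ^ 'n::finite \<Rightarrow> real ^ 'n) \<Rightarrow> 'n metric
    \<Rightarrow> (real ^ 'n \<Rightarrow> real ^ 'n) \<Rightarrow> (real ^ 'n \<Rightarrow> real ^ 'n) \<Rightarrow> real ^ 'n \<Rightarrow> real ^ 'n" where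
  "lie_connection V G X Y x =
     lie_bracket V (nabla G X Y) x - nabla G (lie_bracket V X) Y x - nabla G X (lie_bracket V Y) x"

definition projective_factor :: "'n::finite metric \<Rightarrow> (real ^ 'n \<Rightarrow> real ^ 'n) \<Rightarrow> real ^ 'n \<Rightarrow> real" where
  "projective_factor G V x = divergence G V x / (real CARD('n) + 1)"

section \<open>Projective fields and solitons\<close>

text \<open>\<open>\<LL>\<^sub>V \<nabla>\<close> is a tensor, so the condition may be tested on local vector fields; here they are all
  the smooth vector fields on the domain of a chart.\<close>

definition projective_vector_field ::
    "('a::{t2_space, second_countable_topology}, 'n::finite) chart set \<Rightarrow>
     (('a, 'n) chart \<Rightarrow> 'n metric) \<Rightarrow> (('a, 'n) chart \<Rightarrow> real ^ 'n \<Rightarrow> real ^ 'n) \<Rightarrow> bool" where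
  "projective_vector_field A g V \<longleftrightarrow>
     vector_field A V \<and>
     (\<exists>\<rho>. one_form A \<rho> \<and>
        (\<forall>c\<in>A. \<forall>X Y. smooth_on (cimg c) X \<longrightarrow> smooth_on (cimg c) Y \<longrightarrow>
           (\<forall>x\<in>cimg c. lie_connection (V c) (g c) X Y x =
              \<rho> c x (X x) *\<^sub>R Y x + \<rho> c x (Y x) *\<^sub>R X x)))"

definition almost_omega_bach_soliton ::
    "('a::{t2_space, second_countable_topology}, 'n::finite) chart set \<Rightarrow>
     (('a, 'n) chart \<Rightarrow> 'n metric) \<Rightarrow> (('a, 'n) chart \<Rightarrow> real ^ 'n \<Rightarrow> real ^ 'n) \<Rightarrow> ('a \<Rightarrow> real) \<Rightarrow> real \<Rightarrow>
     (('a, 'n) chart \<Rightarrow> real ^ 'n \<Rightarrow> real ^ 'n \<Rightarrow> real) \<Rightarrow> bool" where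
  "almost_omega_bach_soliton A g V lam \<beta> \<omega> \<longleftrightarrow>
     smooth_atlas A \<and> riemannian_metric A g \<and> vector_field A V \<and> smooth_function A lam \<and> one_form A \<omega> \<and>
     (\<forall>c\<in>A. \<forall>x\<in>cimg c. \<forall>X Y.
        lie_metric (V c) (g c) x X Y / 2 + omega_bach (g c) \<beta> (\<omega> c) x X Y
          = lam (cinv c x) * g c x X Y)"

section \<open>Orthonormal frames\<close>

lemma inner_form_sum_left:
  assumes "inner_form h"
  shows "h (\<Sum>i\<in>I. a i *\<^sub>R e i) w = (\<Sum>i\<in>I. a i * h (e i) w)"
proof -
  have "linear (\<lambda>v. h v w)" using assms by (simp add: inner_form_def bilinear_def)
  from linear_sum[OF this, of "\<lambda>i. a i *\<^sub>R e i" I] linear_scale[OF this]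
  show ?thesis by simp
qed

lemma orthonormal_frame_exists:
  fixes h :: "real ^ 'n::finite \<Rightarrow> real ^ 'n \<Rightarrow> real"
  assumes h: "inner_form h"
  shows "\<exists>e :: 'n \<Rightarrow> real ^ 'n. orthonormal_frame h e"
proof -
  have sym: "\<And>v w. h v w = h w v" and pos: "\<And>v. v \<noteq> 0 \<Longrightarrow> 0 < h v v" and bil: "bilinear h"
    using h by (auto simp: inner_form_def)
  have "\<exists>e :: 'n \<Rightarrow> real ^ 'n. \<forall>i\<in>I. \<forall>j\<in>I. h (e i) (e j) = (if i = j then 1 else 0)"
    if "finite I" for I
    using that
  proof (induction I)
    case empty
    then show ?case by simp
  next
    case (insert a I)
    then obtain e :: "'n \<Rightarrow> real ^ 'n"
      where e: "\<And>i j. i \<in> I \<Longrightarrow> j \<in> I \<Longrightarrow> h (e i) (e j) = (if i = j then 1 else 0)" by blast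
    have "dim (span (e ` I)) \<le> card (e ` I)"
      by (simp add: dim_le_card')
    also have "\<dots> \<le> card I"
      by (simp add: card_image_le insert)
    also have "\<dots> < CARD('n)"
      using insert by (metis UNIV_I finite psubset_card_mono top.not_eq_extremum)
    finally have "dim (e ` I) \<noteq> dim (UNIV :: (real ^ 'n) set)" by simp
    then have "span (e ` I) \<noteq> UNIV" by (metis dim_span)
    then obtain v where v: "v \<notin> span (e ` I)" by auto
    define w where "w = v - (\<Sum>i\<in>I. h v (e i) *\<^sub>R e i)"
    have "w \<noteq> 0"
    proof
      assume "w = 0"
      then have "v = (\<Sum>i\<in>I. h v (e i) *\<^sub>R e i)" by (simp add: w_def)
      then show False using v by (metis (no_types, lifting) imageI span_base span_scale span_sum)
    qed
    then have w: "0 < h w w" by (rule pos)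
    have orth: "h w (e j) = 0" if "j \<in> I" for j
    proof -
      have "h w (e j) = h v (e j) - (\<Sum>i\<in>I. h v (e i) * h (e i) (e j))"
        by (simp add: w_def bilinear_lsub[OF bil] inner_form_sum_left[OF h])
      also have "(\<Sum>i\<in>I. h v (e i) * h (e i) (e j)) = (\<Sum>i\<in>I. if i = j then h v (e i) else 0)"
        by (rule sum.cong) (auto simp: e that)
      also have "\<dots> = h v (e j)" using that insert by simp
      finally show ?thesis by simp
    qed
    define f where "f = e(a := (1 / sqrt (h w w)) *\<^sub>R w)"
    have "h (f i) (f j) = (if i = j then 1 else 0)" if "i \<in> insert a I" "j \<in> insert a I" for i j
      using that e[of i j] orth[of i] orth[of j] sym[of w "e i"] insert(2) w
      by (auto simp: f_def bilinear_lmul[OF bil] bilinear_rmul[OF bil])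
    then show ?case by blast
  qed
  from this[of UNIV] show ?thesis by (simp add: orthonormal_frame_def)
qed

lemma orthonormal_frame_expansion:
  fixes h :: "real ^ 'n::finite \<Rightarrow> real ^ 'n \<Rightarrow> real"
  assumes h: "inner_form h" and e: "orthonormal_frame h (e :: 'n \<Rightarrow> real ^ 'n)"
  shows "v = (\<Sum>i\<in>UNIV. h v (e i) *\<^sub>R e i)"
proof -
  have bil: "bilinear h" using h by (auto simp: inner_form_def)
  have coeff: "h (\<Sum>i\<in>UNIV. a i *\<^sub>R e i) (e j) = a j" for a j
  proof -
    have "(\<Sum>i\<in>UNIV. a i * h (e i) (e j)) = (\<Sum>i\<in>UNIV. if i = j then a i else 0)"
      using e by (intro sum.cong) (auto simp: orthonormal_frame_def)
    then show ?thesis by (simp add: inner_form_sum_left[OF h])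
  qed
  have inj: "inj e"
    using e by (auto simp: inj_def orthonormal_frame_def) (metis zero_neq_one)
  have "independent (range e)"
  proof (rule independent_if_scalars_zero)
    fix a x assume *: "(\<Sum>x\<in>range e. a x *\<^sub>R x) = 0" and "x \<in> range e"
    then obtain j where j: "x = e j" by auto
    have "(\<Sum>i\<in>UNIV. a (e i) *\<^sub>R e i) = 0" using * by (simp add: sum.reindex inj)
    then have "h (\<Sum>i\<in>UNIV. a (e i) *\<^sub>R e i) (e j) = 0"
      using bilinear_lzero[OF bil] by simp
    then show "a x = 0" using coeff[of "\<lambda>i. a (e i)" j] j by simp
  qed simp
  moreover have "card (range e) = CARD('n)" by (simp add: card_image inj)
  ultimately have "span (range e) = UNIV"
    by (metis DIM_cart DIM_real dim_eq_full dim_span_eq_card_independent dim_span nat_mult_1_right)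
  then have "v \<in> span (range e)" by simp
  then obtain a where "v = (\<Sum>x\<in>range e. a x *\<^sub>R x)"
    by (auto simp: span_finite)
  then have v: "v = (\<Sum>i\<in>UNIV. a (e i) *\<^sub>R e i)" by (simp add: sum.reindex inj)
  then have "h v (e j) = a (e j)" for j using coeff[of "\<lambda>i. a (e i)" j] by simp
  then show ?thesis using v by simp
qed

lemma orthonormal_frame_trace:
  fixes h T :: "real ^ 'n::finite \<Rightarrow> real ^ 'n \<Rightarrow> real"
  assumes h: "inner_form h"
    and e: "orthonormal_frame h (e :: 'n \<Rightarrow> real ^ 'n)"
    and f: "orthonormal_frame h (f :: 'n \<Rightarrow> real ^ 'n)"
    and T: "bilinear T"
  shows "(\<Sum>i\<in>UNIV. T (e i) (e i)) = (\<Sum>i\<in>UNIV. T (f i) (f i))"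
proof -
  have T1: "linear (\<lambda>v. T v w)" and T2: "linear (T w)" for w
    using T by (auto simp: bilinear_def)
  have sym: "\<And>v w. h v w = h w v" using h by (auto simp: inner_form_def)
  have "(\<Sum>i\<in>UNIV. T (e i) (e i)) = (\<Sum>i\<in>UNIV. T (\<Sum>j\<in>UNIV. h (e i) (f j) *\<^sub>R f j) (e i))"
    by (simp flip: orthonormal_frame_expansion[OF h f])
  also have "\<dots> = (\<Sum>i\<in>UNIV. \<Sum>j\<in>UNIV. T (f j) (h (f j) (e i) *\<^sub>R e i))"
    by (simp add: linear_sum[OF T1] linear_scale[OF T1] linear_scale[OF T2] sym)
  also have "\<dots> = (\<Sum>j\<in>UNIV. \<Sum>i\<in>UNIV. T (f j) (h (f j) (e i) *\<^sub>R e i))"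
    by (rule sum.swap)
  also have "\<dots> = (\<Sum>j\<in>UNIV. T (f j) (\<Sum>i\<in>UNIV. h (f j) (e i) *\<^sub>R e i))"
    by (simp add: linear_sum[OF T2])
  also have "\<dots> = (\<Sum>j\<in>UNIV. T (f j) (f j))"
    by (simp flip: orthonormal_frame_expansion[OF h e])
  finally show ?thesis .
qed

text \<open>The definite descriptions in \<open>christoffel\<close> and \<open>gradient\<close> are justified by the following
  lemma.\<close>

lemma inner_form_representation:
  fixes h :: "real ^ 'n::finite \<Rightarrow> real ^ 'n \<Rightarrow> real"
  assumes h: "inner_form h" and f: "linear f"
  shows "\<exists>!u. \<forall>z. h u z = f z"
proof -
  obtain e :: "'n \<Rightarrow> real ^ 'n" where e: "orthonormal_frame h e"
    using orthonormal_frame_exists[OF h] by blast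
  have sym: "\<And>v w. h v w = h w v" and pos: "\<And>v. v \<noteq> 0 \<Longrightarrow> 0 < h v v" and bil: "bilinear h"
    using h by (auto simp: inner_form_def)
  define w where "w = (\<Sum>i\<in>UNIV. f (e i) *\<^sub>R e i)"
  have w: "h w z = f z" for z
  proof -
    have "f z = f (\<Sum>i\<in>UNIV. h z (e i) *\<^sub>R e i)"
      by (simp flip: orthonormal_frame_expansion[OF h e])
    also have "\<dots> = (\<Sum>i\<in>UNIV. h z (e i) * f (e i))"
      by (simp add: linear_sum[OF f] linear_scale[OF f])
    finally show ?thesis by (simp add: w_def inner_form_sum_left[OF h] sym[of z] mult.commute)
  qed
  have "u = w" if "\<forall>z. h u z = f z" for u
  proof -
    have "h (u - w) (u - w) = 0" using that w by (simp add: bilinear_lsub[OF bil])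
    then show ?thesis using pos[of "u - w"] by fastforce
  qed
  then show ?thesis using w by blast
qed

end

theory Submission
  imports Defs
begin

text \<open>Write \<open>h\<close> for the Lie derivative of \<open>g\<close> along \<open>V\<close>. If \<open>V\<close> is projective with one-form \<open>\<rho>\<close>, then
  \<open>(\<nabla>\<^sub>X h)(Y, Z) = 2 \<rho>(X) g(Y, Z) + \<rho>(Y) g(X, Z) + \<rho>(Z) g(X, Y)\<close>. The trace over \<open>Y, Z\<close> shows
  \<open>\<rho> = d\<phi>\<close>, and the trace over \<open>X, Y\<close> gives \<open>div h = (n + 3) d\<phi>\<close>, so that the divergence of the
  soliton equation is \<open>div B\<^sub>\<omega> = d\<lambda> - (n + 3)/2 d\<phi>\<close>. The Bach tensor is trace-free because the Weyl
  tensor is and traces commute with \<open>\<nabla>\<close>; hence the trace of the soliton equation is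
  \<open>(n + 1) \<phi> = n \<lambda> + \<beta> |P|\<^sup>2\<close>. Eliminating \<open>d\<lambda>\<close>, respectively \<open>d\<phi>\<close>, gives the claims.\<close>

section \<open>Smooth functions\<close>

text \<open>All claims are decided at one point of one chart, so the work is calculus on an open
  subset of \<open>real ^ 'n\<close>. The formula for the covariant derivative of h is the Lie
  derivative along V of metric compatibility: commuting the two operations leaves exactly the terms
  in which \<open>lie_connection\<close> acts on a slot of g. The divergence never needs B expanded:
  the soliton equation turns B_\<omega> into \<lambda> g - h/2, and B itself enters only through its
  trace. What shapes the proof is differentiability: connection, curvature and traces come from
  definite descriptions and pointwise choices, and each must be shown smooth before a product rule
  applies. The number n^2 + n - 2 comes from (n + 3)/2 - (n + 1)/n = (n^2 + n - 2)/(2n), the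
  coefficient of d\<phi> once d\<lambda> is eliminated.\<close>

lemma dd_eq: "(f has_derivative f') (at x) \<Longrightarrow> dd f x v = f' v"
  unfolding dd_def by (metis frechet_derivative_at)

lemma has_derivative_dd: "f differentiable at x \<Longrightarrow> (f has_derivative dd f x) (at x)"
  using frechet_derivative_works[of f "at x"] by (simp add: dd_def[abs_def])

lemma linear_dd: "f differentiable at x \<Longrightarrow> linear (dd f x)"
  using has_derivative_dd has_derivative_linear by blast

lemma dd_const [simp]: "dd (\<lambda>_. c) x v = 0"
  by (rule dd_eq[where f' = "\<lambda>_. 0"]) auto

lemma dd_add:
  "f differentiable at x \<Longrightarrow> g differentiable at x \<Longrightarrow>
     dd (\<lambda>y. f y + g y) x v = dd f x v + dd g x v"
  by (rule dd_eq[where f' = "\<lambda>v. dd f x v + dd g x v"]) (intro derivative_intros has_derivative_dd)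

lemma dd_diff:
  "f differentiable at x \<Longrightarrow> g differentiable at x \<Longrightarrow>
     dd (\<lambda>y. f y - g y) x v = dd f x v - dd g x v"
  by (rule dd_eq[where f' = "\<lambda>v. dd f x v - dd g x v"]) (intro derivative_intros has_derivative_dd)

lemma dd_sum:
  "(\<And>i. i \<in> I \<Longrightarrow> f i differentiable at x) \<Longrightarrow>
     dd (\<lambda>y. \<Sum>i\<in>I. f i y) x v = (\<Sum>i\<in>I. dd (f i) x v)"
  by (rule dd_eq[where f' = "\<lambda>v. \<Sum>i\<in>I. dd (f i) x v"]) (intro derivative_intros has_derivative_dd)

lemma dd_bounded_bilinear:
  assumes "bounded_bilinear B" "f differentiable at x" "g differentiable at x"
  shows "dd (\<lambda>y. B (f y) (g y)) x v = B (f x) (dd g x v) + B (dd f x v) (g x)"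
  by (rule dd_eq[OF bounded_bilinear.FDERIV[OF assms(1)]])
    (use assms in \<open>auto intro: has_derivative_dd\<close>)

lemmas dd_mult = dd_bounded_bilinear[OF bounded_bilinear_mult]

lemma dd_bounded_linear:
  assumes "bounded_linear B" "f differentiable at x"
  shows "dd (\<lambda>y. B (f y)) x v = B (dd f x v)"
  by (rule dd_eq[OF bounded_linear.has_derivative[OF assms(1)]])
    (use assms in \<open>auto intro: has_derivative_dd\<close>)

lemma has_derivative_cong_open:
  assumes "open S" "x \<in> S" "\<And>y. y \<in> S \<Longrightarrow> f y = g y"
  shows "(f has_derivative D) (at x) \<longleftrightarrow> (g has_derivative D) (at x)"
  using assms by (metis has_derivative_transform_within_open)

text \<open>Functions that agree near x have the same derivatives there, so the choice made by
  \<open>frechet_derivative\<close> is the same for both, whether or not a derivative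
  exists.\<close>

lemma dd_cong:
  assumes "open S" "x \<in> S" "\<And>y. y \<in> S \<Longrightarrow> f y = g y"
  shows "dd f x v = dd g x v"
  by (simp add: dd_def frechet_derivative_def has_derivative_cong_open[OF assms])

lemma differentiable_cong_open:
  assumes "open S" "x \<in> S" "\<And>y. y \<in> S \<Longrightarrow> f y = g y"
  shows "f differentiable at x \<longleftrightarrow> g differentiable at x"
  by (simp add: differentiable_def has_derivative_cong_open[OF assms])

lemma Ck_on_cong:
  assumes "open S" "\<And>x. x \<in> S \<Longrightarrow> f x = g x"
  shows "Ck_on k S f \<longleftrightarrow> Ck_on k S g"
  using assms(2)
proof (induction k arbitrary: f g)
  case 0
  then show ?case by (simp cong: continuous_on_cong)
next
  case (Suc k)
  have "f differentiable_on S \<longleftrightarrow> g differentiable_on S"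
    using differentiable_cong_open[OF assms(1) _ Suc.prems]
    by (simp add: differentiable_on_eq_differentiable_at[OF assms(1)])
  moreover have "Ck_on k S (\<lambda>x. dd f x v) \<longleftrightarrow> Ck_on k S (\<lambda>x. dd g x v)" for v
    by (rule Suc.IH, rule dd_cong[OF assms(1)]) (use Suc.prems in auto)
  ultimately show ?case by simp
qed

lemma Ck_on_Suc_imp: "Ck_on (Suc k) S f \<Longrightarrow> Ck_on k S f"
proof (induction k arbitrary: f)
  case 0
  then show ?case by (simp add: differentiable_imp_continuous_on)
next
  case (Suc k)
  from Suc.prems have "f differentiable_on S" "\<And>v. Ck_on (Suc k) S (\<lambda>x. dd f x v)" by auto
  then show ?case using Suc.IH by auto
qed

section \<open>Algebra of \<open>Ck_on\<close> and of smooth functions\<close>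

lemma Ck_on_const: "Ck_on k S (\<lambda>_. c)"
  by (induction k arbitrary: c) auto

lemma Ck_on_add:
  "open S \<Longrightarrow> Ck_on k S f \<Longrightarrow> Ck_on k S g \<Longrightarrow> Ck_on k S (\<lambda>x. f x + g x)"
proof (induction k arbitrary: f g)
  case 0
  then show ?case by (simp add: continuous_on_add)
next
  case (Suc k)
  have "Ck_on k S (\<lambda>x. dd (\<lambda>y. f y + g y) x v) \<longleftrightarrow> Ck_on k S (\<lambda>x. dd f x v + dd g x v)" for v
    using Suc.prems
    by (intro Ck_on_cong dd_add) (auto simp: differentiable_on_eq_differentiable_at)
  then show ?case using Suc by (auto intro: differentiable_on_add)
qed

text \<open>One induction serves products of reals, scaling and the inner product. The product rule
  pairs each factor with a derivative of the other, so at the next order the undifferentiated factor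
  is lowered by \<open>Ck_on_Suc_imp\<close>.\<close>

lemma Ck_on_bounded_bilinear:
  assumes B: "bounded_bilinear B" and S: "open S"
  shows "Ck_on k S f \<Longrightarrow> Ck_on k S g \<Longrightarrow> Ck_on k S (\<lambda>x. B (f x) (g x))"
proof (induction k arbitrary: f g)
  case 0
  then show ?case by (simp add: bounded_bilinear.continuous_on[OF B])
next
  case (Suc k)
  have d: "f differentiable at x" "g differentiable at x" if "x \<in> S" for x
    using Suc.prems that by (auto simp: differentiable_on_eq_differentiable_at[OF S])
  have "Ck_on k S (\<lambda>x. dd (\<lambda>y. B (f y) (g y)) x v)
      \<longleftrightarrow> Ck_on k S (\<lambda>x. B (f x) (dd g x v) + B (dd f x v) (g x))" for v
    by (intro Ck_on_cong dd_bounded_bilinear[OF B] S d)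
  moreover have "Ck_on k S f" "Ck_on k S g" using Suc.prems Ck_on_Suc_imp by blast+
  moreover have "(\<lambda>x. B (f x) (g x)) differentiable at x" if "x \<in> S" for x
    using bounded_bilinear.FDERIV[OF B has_derivative_dd has_derivative_dd, OF d, OF that that]
    by (auto simp: differentiable_def)
  ultimately show ?case
    using Suc by (auto intro!: Ck_on_add S simp: differentiable_on_eq_differentiable_at[OF S])
qed

text \<open>The derivative of 1/f is a product of -df with two copies of 1/f, so one more order for
  1/f only requires the previous order of 1/f itself.\<close>

lemma Ck_on_inverse:
  fixes f :: "'a::euclidean_space \<Rightarrow> real"
  assumes S: "open S" and nz: "\<And>x. x \<in> S \<Longrightarrow> f x \<noteq> 0"
  shows "Ck_on k S f \<Longrightarrow> Ck_on k S (\<lambda>x. inverse (f x))"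
proof (induction k)
  case 0
  then show ?case using nz by (auto intro: continuous_on_inverse)
next
  case (Suc k)
  have D: "((\<lambda>y. inverse (f y)) has_derivative (\<lambda>v. - (inverse (f x) * dd f x v * inverse (f x)))) (at x)"
    if "x \<in> S" for x
    using Suc.prems that nz
    by (intro Deriv.has_derivative_inverse has_derivative_dd)
      (auto simp: differentiable_on_eq_differentiable_at[OF S])
  have "Ck_on k S (\<lambda>x. dd (\<lambda>y. inverse (f y)) x v)
      \<longleftrightarrow> Ck_on k S (\<lambda>x. (-1) * (inverse (f x) * dd f x v * inverse (f x)))" for v
    by (intro Ck_on_cong S) (simp add: dd_eq[OF D])
  moreover have "Ck_on k S (\<lambda>x. (-1) * (inverse (f x) * dd f x v * inverse (f x)))" for v
    using Suc Ck_on_Suc_imp[OF Suc.prems]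
    by (intro Ck_on_bounded_bilinear[OF bounded_bilinear_mult] S Ck_on_const) auto
  ultimately have "Ck_on k S (\<lambda>x. dd (\<lambda>y. inverse (f y)) x v)" for v by blast
  then show ?case
    using D by (auto simp: differentiable_on_eq_differentiable_at[OF S] differentiable_def)
qed

lemma smooth_on_const [simp]: "smooth_on S (\<lambda>_. c)"
  by (simp add: smooth_on_def Ck_on_const)

lemma smooth_on_cong:
  "open S \<Longrightarrow> (\<And>x. x \<in> S \<Longrightarrow> f x = g x) \<Longrightarrow> smooth_on S f \<longleftrightarrow> smooth_on S g"
  unfolding smooth_on_def using Ck_on_cong by blast

lemma smooth_on_dd: "smooth_on S f \<Longrightarrow> smooth_on S (\<lambda>x. dd f x v)"
  unfolding smooth_on_def by (metis Ck_on.simps(2))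

lemma smooth_on_differentiable_on: "smooth_on S f \<Longrightarrow> f differentiable_on S"
  unfolding smooth_on_def by (metis Ck_on.simps(2))

lemma smooth_on_differentiable: "smooth_on S f \<Longrightarrow> open S \<Longrightarrow> x \<in> S \<Longrightarrow> f differentiable at x"
  using smooth_on_differentiable_on differentiable_on_eq_differentiable_at by blast

lemma smooth_on_add:
  "open S \<Longrightarrow> smooth_on S f \<Longrightarrow> smooth_on S g \<Longrightarrow> smooth_on S (\<lambda>x. f x + g x)"
  by (simp add: smooth_on_def Ck_on_add)

lemma smooth_on_bounded_bilinear:
  "bounded_bilinear B \<Longrightarrow> open S \<Longrightarrow> smooth_on S f \<Longrightarrow> smooth_on S g \<Longrightarrow>
     smooth_on S (\<lambda>x. B (f x) (g x))"
  by (simp add: smooth_on_def Ck_on_bounded_bilinear)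

lemmas smooth_on_scaleR = smooth_on_bounded_bilinear[OF bounded_bilinear_scaleR]
lemmas smooth_on_mult = smooth_on_bounded_bilinear[OF bounded_bilinear_mult]

lemma smooth_on_uminus: "open S \<Longrightarrow> smooth_on S f \<Longrightarrow> smooth_on S (\<lambda>x. - f x)"
  using smooth_on_scaleR[of S "\<lambda>_. -1" f] by simp

lemma smooth_on_diff:
  "open S \<Longrightarrow> smooth_on S f \<Longrightarrow> smooth_on S g \<Longrightarrow> smooth_on S (\<lambda>x. f x - g x)"
  using smooth_on_add[of S f "\<lambda>x. - g x"] smooth_on_uminus[of S g] by simp

lemma smooth_on_sum:
  "open S \<Longrightarrow> (\<And>i. i \<in> I \<Longrightarrow> smooth_on S (f i)) \<Longrightarrow> smooth_on S (\<lambda>x. \<Sum>i\<in>I. f i x)"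
  by (induction I rule: infinite_finite_induct) (auto intro: smooth_on_add)

lemma smooth_on_prod:
  fixes f :: "'i \<Rightarrow> 'a::euclidean_space \<Rightarrow> real"
  shows "open S \<Longrightarrow> (\<And>i. i \<in> I \<Longrightarrow> smooth_on S (f i)) \<Longrightarrow> smooth_on S (\<lambda>x. \<Prod>i\<in>I. f i x)"
  by (induction I rule: infinite_finite_induct) (auto intro: smooth_on_mult)

lemma smooth_on_divide:
  fixes f g :: "'a::euclidean_space \<Rightarrow> real"
  assumes "open S" "smooth_on S f" "smooth_on S g" "\<And>x. x \<in> S \<Longrightarrow> g x \<noteq> 0"
  shows "smooth_on S (\<lambda>x. f x / g x)"
  using assms smooth_on_mult[of S f "\<lambda>x. inverse (g x)"]
  by (simp add: divide_inverse smooth_on_def Ck_on_inverse)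

text \<open>The Leibniz formula is a polynomial in the entries. This serves Cramer's rule in
  \<open>smooth_on_representation\<close>.\<close>

lemma smooth_on_det:
  fixes M :: "'a::euclidean_space \<Rightarrow> 'n::finite \<Rightarrow> 'n \<Rightarrow> real"
  assumes "open S" "\<And>i j. smooth_on S (\<lambda>x. M x i j)"
  shows "smooth_on S (\<lambda>x. det (\<chi> i j. M x i j))"
  unfolding det_def using assms
  by (auto intro!: smooth_on_sum smooth_on_mult smooth_on_prod)

lemma smooth_on_vec:
  fixes u :: "'a::euclidean_space \<Rightarrow> real ^ 'n::finite"
  assumes "open S" "\<And>k. smooth_on S (\<lambda>x. u x $ k)"
  shows "smooth_on S u"
proof -
  have "smooth_on S (\<lambda>x. \<Sum>k\<in>UNIV. (u x $ k) *\<^sub>R axis k 1)"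
    using assms by (intro smooth_on_sum smooth_on_scaleR) auto
  then show ?thesis
    by (rule smooth_on_cong[OF assms(1), THEN iffD2, rotated])
      (simp add: basis_expansion flip: scalar_mult_eq_scaleR)
qed

section \<open>Fields linear in an argument, evaluated on a varying argument\<close>

lemma expand_linear_arg:
  fixes F :: "'b::euclidean_space \<Rightarrow> 'c::real_vector"
  shows "linear F \<Longrightarrow> F w = (\<Sum>b\<in>Basis. (w \<bullet> b) *\<^sub>R F b)"
  using linear_sum[of F "\<lambda>b. (w \<bullet> b) *\<^sub>R b" Basis]
  by (simp add: euclidean_representation linear_scale)

text \<open>Smoothness of a tensor is recorded for constant arguments only; expanding
  \<open>u x\<close> in the constant \<open>Basis\<close> reduces a varying argument to that
  case.\<close>

lemma smooth_on_linear_arg: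
  fixes F :: "'a::euclidean_space \<Rightarrow> 'b::euclidean_space \<Rightarrow> 'c::real_normed_vector"
  assumes S: "open S" and "\<And>x. x \<in> S \<Longrightarrow> linear (F x)" "\<And>w. smooth_on S (\<lambda>x. F x w)" "smooth_on S u"
  shows "smooth_on S (\<lambda>x. F x (u x))"
proof -
  have "smooth_on S (\<lambda>x. F x (u x)) \<longleftrightarrow> smooth_on S (\<lambda>x. \<Sum>b\<in>Basis. (u x \<bullet> b) *\<^sub>R F x b)"
    using assms by (intro smooth_on_cong expand_linear_arg) auto
  moreover have "smooth_on S (\<lambda>x. \<Sum>b\<in>Basis. (u x \<bullet> b) *\<^sub>R F x b)"
    using assms
    by (intro smooth_on_sum smooth_on_scaleR smooth_on_bounded_bilinear[OF bounded_bilinear_inner]) auto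
  ultimately show ?thesis by simp
qed

lemma dd_linear_arg:
  fixes F :: "'a::euclidean_space \<Rightarrow> 'b::euclidean_space \<Rightarrow> 'c::real_normed_vector"
  assumes S: "open S" "x \<in> S" and lin: "\<And>y. y \<in> S \<Longrightarrow> linear (F y)"
    and F: "\<And>w. (\<lambda>y. F y w) differentiable at x" and u: "u differentiable at x"
  shows "dd (\<lambda>y. F y (u y)) x v = dd (\<lambda>y. F y (u x)) x v + F x (dd u x v)"
proof -
  have *: "dd (\<lambda>y. F y (w y)) x v
      = (\<Sum>b\<in>Basis. (w x \<bullet> b) *\<^sub>R dd (\<lambda>y. F y b) x v + (dd w x v \<bullet> b) *\<^sub>R F x b)"
    if w: "w differentiable at x" for w
  proof -
    have "dd (\<lambda>y. F y (w y)) x v = dd (\<lambda>y. \<Sum>b\<in>Basis. (w y \<bullet> b) *\<^sub>R F y b) x v"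
      by (rule dd_cong[OF S], rule expand_linear_arg[OF lin])
    also have "\<dots> = (\<Sum>b\<in>Basis. (w x \<bullet> b) *\<^sub>R dd (\<lambda>y. F y b) x v + (dd w x v \<bullet> b) *\<^sub>R F x b)"
      by (rule dd_eq[where f' = "\<lambda>v. \<Sum>b\<in>Basis. (w x \<bullet> b) *\<^sub>R dd (\<lambda>y. F y b) x v + (dd w x v \<bullet> b) *\<^sub>R F x b"])
        (intro has_derivative_sum has_derivative_scaleR has_derivative_inner_left has_derivative_dd w F)
    finally show ?thesis .
  qed
  \<comment> \<open>For the constant field \<open>\<lambda>_. u x\<close> the same expansion
    identifies the first half of the sum as the derivative with frozen argument; the second half is
    linearity of \<open>F x\<close>.\<close>
  show ?thesis
    using *[OF u] *[of "\<lambda>_. u x"] expand_linear_arg[OF lin[OF S(2)], of "dd u x v"]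
    by (simp add: sum.distrib)
qed

text \<open>Linearity of F near x passes to the derivative. Coordinate derivatives of tensors thus
  stay multilinear in the slots, as the trace lemmas require.\<close>

lemma linear_dd_arg:
  fixes F :: "'a::euclidean_space \<Rightarrow> 'b::euclidean_space \<Rightarrow> 'c::real_normed_vector"
  assumes S: "open S" "x \<in> S" and lin: "\<And>y. y \<in> S \<Longrightarrow> linear (F y)"
    and F: "\<And>w. (\<lambda>y. F y w) differentiable at x"
  shows "linear (\<lambda>w. dd (\<lambda>y. F y w) x v)"
proof (rule linearI)
  fix a b
  have "dd (\<lambda>y. F y (a + b)) x v = dd (\<lambda>y. F y a + F y b) x v"
    by (rule dd_cong[OF S]) (simp add: linear_add lin)
  then show "dd (\<lambda>y. F y (a + b)) x v = dd (\<lambda>y. F y a) x v + dd (\<lambda>y. F y b) x v"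
    by (simp add: dd_add F)
next
  fix r a
  have "dd (\<lambda>y. F y (r *\<^sub>R a)) x v = dd (\<lambda>y. r *\<^sub>R F y a) x v"
    by (rule dd_cong[OF S]) (simp add: linear_scale lin)
  then show "dd (\<lambda>y. F y (r *\<^sub>R a)) x v = r *\<^sub>R dd (\<lambda>y. F y a) x v"
    by (simp add: dd_bounded_linear[OF bounded_linear_scaleR_right] F)
qed

section \<open>Symmetry of second derivatives\<close>

lemma second_difference:
  fixes f :: "'a::euclidean_space \<Rightarrow> real"
  assumes S: "open S" "smooth_on S f" and B: "ball x r \<subseteq> S" and t: "0 < t" "t * (norm v + norm w) < r"
  shows "\<exists>z\<in>ball x r. f (x + t *\<^sub>R v + t *\<^sub>R w) - f (x + t *\<^sub>R v) - f (x + t *\<^sub>R w) + f x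
      = t * (t * dd (\<lambda>y. dd f y v) z w)"
proof -
  \<comment> \<open>The bound on t keeps the whole parallelogram spanned by
    \<open>t *\<^sub>R v\<close> and \<open>t *\<^sub>R w\<close> inside the ball, so both mean
    value arguments stay in S.\<close>
  have mem: "x + p *\<^sub>R v + q *\<^sub>R w \<in> ball x r" if "0 \<le> p" "p \<le> t" "0 \<le> q" "q \<le> t" for p q
  proof -
    have "norm (p *\<^sub>R v + q *\<^sub>R w) \<le> p * norm v + q * norm w"
      using norm_triangle_ineq[of "p *\<^sub>R v" "q *\<^sub>R w"] that by simp
    also have "\<dots> \<le> t * norm v + t * norm w"
      using that by (intro add_mono mult_right_mono) auto
    also have "\<dots> < r" using t by (simp add: algebra_simps)
    finally have "dist (x + (p *\<^sub>R v + q *\<^sub>R w)) x < r" by (simp add: dist_norm)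
    then show ?thesis by (simp only: mem_ball dist_commute add.assoc)
  qed
  have deriv: "((\<lambda>s. h (a + s *\<^sub>R b + c)) has_real_derivative dd h (a + s *\<^sub>R b + c) b) (at s)"
    if "smooth_on S h" "a + s *\<^sub>R b + c \<in> ball x r" for h :: "'a \<Rightarrow> real" and a b c s
  proof -
    have d: "h differentiable at (a + s *\<^sub>R b + c)"
      using that S B by (intro smooth_on_differentiable[of S]) auto
    have "((\<lambda>s. a + s *\<^sub>R b + c) has_derivative (\<lambda>s. s *\<^sub>R b)) (at s)"
      by (auto intro!: derivative_eq_intros)
    from has_derivative_compose[OF this has_derivative_dd[OF d]] linear_scale[OF linear_dd[OF d]]
    show ?thesis by (simp add: has_field_derivative_def mult_commute_abs)
  qed
  \<comment> \<open>Mean value theorem along v, applied to the increment of f in direction w. The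
    summands with factor 0 keep the shape that \<open>deriv\<close> matches.\<close>
  have "\<exists>p>0. p < t \<and> (f (x + t *\<^sub>R v + t *\<^sub>R w) - f (x + t *\<^sub>R v + 0 *\<^sub>R w))
        - (f (x + 0 *\<^sub>R v + t *\<^sub>R w) - f (x + 0 *\<^sub>R v + 0 *\<^sub>R w))
      = (t - 0) * (dd f (x + p *\<^sub>R v + t *\<^sub>R w) v - dd f (x + p *\<^sub>R v + 0 *\<^sub>R w) v)"
    using mem[of _ 0] mem[of _ t] t S(2)
    by (intro MVT2[of 0 t "\<lambda>p. f (x + p *\<^sub>R v + t *\<^sub>R w) - f (x + p *\<^sub>R v + 0 *\<^sub>R w)"
          "\<lambda>p. dd f (x + p *\<^sub>R v + t *\<^sub>R w) v - dd f (x + p *\<^sub>R v + 0 *\<^sub>R w) v"] DERIV_diff deriv) auto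
  then obtain p where p: "0 < p" "p < t"
    and 1: "f (x + t *\<^sub>R v + t *\<^sub>R w) - f (x + t *\<^sub>R v) - f (x + t *\<^sub>R w) + f x
      = t * (dd f (x + p *\<^sub>R v + t *\<^sub>R w) v - dd f (x + p *\<^sub>R v) v)"
    by (auto simp: algebra_simps)
  \<comment> \<open>Mean value theorem along w, applied to the derivative of f in direction
    v.\<close>
  have "\<exists>q>0. q < t \<and> dd f (x + p *\<^sub>R v + t *\<^sub>R w + 0) v - dd f (x + p *\<^sub>R v + 0 *\<^sub>R w + 0) v
      = (t - 0) * dd (\<lambda>y. dd f y v) (x + p *\<^sub>R v + q *\<^sub>R w + 0) w"
    using mem[of p] p t S(2)
    by (intro MVT2[of 0 t "\<lambda>q. dd f (x + p *\<^sub>R v + q *\<^sub>R w + 0) v"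
          "\<lambda>q. dd (\<lambda>y. dd f y v) (x + p *\<^sub>R v + q *\<^sub>R w + 0) w"] deriv smooth_on_dd) auto
  then obtain q where "0 < q" "q < t"
    "dd f (x + p *\<^sub>R v + t *\<^sub>R w) v - dd f (x + p *\<^sub>R v) v = t * dd (\<lambda>y. dd f y v) (x + p *\<^sub>R v + q *\<^sub>R w) w"
    by auto
  with 1 p show ?thesis by (intro bexI[OF _ mem[of p q]]) auto
qed

text \<open>The second difference is symmetric in v and w, so the two mixed derivatives agree at
  points z and z', possibly distinct but as close to x as desired. Continuity then rules out a gap
  at x.\<close>

lemma dd_commute:
  fixes f :: "'a::euclidean_space \<Rightarrow> real"
  assumes S: "open S" "smooth_on S f" "x \<in> S"
  shows "dd (\<lambda>y. dd f y v) x w = dd (\<lambda>y. dd f y w) x v"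
proof (rule ccontr)
  let ?a = "\<lambda>x. dd (\<lambda>y. dd f y v) x w" and ?b = "\<lambda>x. dd (\<lambda>y. dd f y w) x v"
  assume ne: "?a x \<noteq> ?b x"
  \<comment> \<open>Half the gap: two values closer than e to \<open>?a x\<close> and
    \<open>?b x\<close> respectively cannot coincide.\<close>
  define e where "e = \<bar>?a x - ?b x\<bar> / 2"
  have "e > 0" using ne by (simp add: e_def)
  have cont: "isCont ?a x" "isCont ?b x"
    using S by (auto intro!: differentiable_imp_continuous_within smooth_on_differentiable smooth_on_dd)
  obtain r0 where r0: "r0 > 0" "ball x r0 \<subseteq> S" using S by (meson open_contains_ball)
  obtain r1 where r1: "r1 > 0" "\<And>y. dist y x < r1 \<Longrightarrow> dist (?a y) (?a x) < e"
    using cont(1) \<open>e > 0\<close> by (auto simp: continuous_at_eps_delta dist_norm)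
  obtain r2 where r2: "r2 > 0" "\<And>y. dist y x < r2 \<Longrightarrow> dist (?b y) (?b x) < e"
    using cont(2) \<open>e > 0\<close> by (auto simp: continuous_at_eps_delta dist_norm)
  define r where "r = min r0 (min r1 r2)"
  have r: "r > 0" "ball x r \<subseteq> S" using r0 r1 r2 by (auto simp: r_def)
  \<comment> \<open>The summand 1 keeps the denominator positive when v and w vanish and makes the
    bound \<open>tr\<close> strict.\<close>
  define t where "t = r / (norm v + norm w + 1)"
  have pos: "norm v + norm w + 1 > 0" by (simp add: add_nonneg_pos)
  have t: "0 < t" using r pos by (simp add: t_def)
  have "t * (norm v + norm w) < t * (norm v + norm w + 1)" using t by simp
  also have "\<dots> = r" using pos by (simp add: t_def)
  finally have tr: "t * (norm v + norm w) < r" .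
  from second_difference[OF S(1,2) r(2) t tr] obtain z where z: "z \<in> ball x r"
    "f (x + t *\<^sub>R v + t *\<^sub>R w) - f (x + t *\<^sub>R v) - f (x + t *\<^sub>R w) + f x = t * (t * ?a z)" by blast
  from second_difference[OF S(1,2) r(2) t, of w v] tr obtain z' where z': "z' \<in> ball x r"
    "f (x + t *\<^sub>R w + t *\<^sub>R v) - f (x + t *\<^sub>R w) - f (x + t *\<^sub>R v) + f x = t * (t * ?b z')"
    by (auto simp: add.commute)
  have "t * (t * ?a z) = t * (t * ?b z')"
    using z(2) z'(2) by (simp add: algebra_simps)
  then have "?a z = ?b z'" using t by simp
  moreover have "dist (?a z) (?a x) < e" "dist (?b z') (?b x) < e"
    using z z' r1(2)[of z] r2(2)[of z'] by (auto simp: r_def dist_commute)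
  ultimately show False by (auto simp: e_def dist_real_def abs_if split: if_splits)
qed

section \<open>The Levi-Civita connection and traces in a chart\<close>

lemma linear_compose': "linear f \<Longrightarrow> linear g \<Longrightarrow> linear (\<lambda>x. g (f x))"
  using linear_compose[of f g] by (simp add: o_def)

lemma linear_mult_right: "linear f \<Longrightarrow> linear (\<lambda>x. c * f x :: real)"
  using linear_compose_scale_right[of f c] by simp

lemma linear_mult_left: "linear f \<Longrightarrow> linear (\<lambda>x. f x * c :: real)"
  using linear_mult_right[of f c] by (simp add: mult.commute)

lemma bilinear_sum:
  assumes "\<And>i. i \<in> I \<Longrightarrow> bilinear (T i)"
  shows "bilinear (\<lambda>v w. \<Sum>i\<in>I. T i v w)"
  using assms by (auto simp: bilinear_def intro!: linear_compose_sum)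

text \<open>Models the image of a single chart with the metric on it; the theorem instantiates it
  with \<open>cimg c\<close> and \<open>g c\<close>.\<close>

locale chart_metric =
  fixes S :: "(real ^ 'n::finite) set" and G :: "'n metric"
  assumes open_S: "open S"
    and inner_form_G: "x \<in> S \<Longrightarrow> inner_form (G x)"
    and smooth_G: "smooth_on S (\<lambda>x. G x v w)"
begin

lemma G_sym: "x \<in> S \<Longrightarrow> G x v w = G x w v"
  using inner_form_G by (auto simp: inner_form_def)

lemma linear_G_left: "x \<in> S \<Longrightarrow> linear (\<lambda>v. G x v w)"
  using inner_form_G by (auto simp: inner_form_def bilinear_def)

lemma linear_G_right: "x \<in> S \<Longrightarrow> linear (\<lambda>w. G x v w)"
  using inner_form_G by (auto simp: inner_form_def bilinear_def)

lemma bilinear_G: "x \<in> S \<Longrightarrow> bilinear (G x)"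
  using inner_form_G by (auto simp: inner_form_def)

lemmas G_simps = bilinear_ladd[OF bilinear_G] bilinear_radd[OF bilinear_G]
  bilinear_lsub[OF bilinear_G] bilinear_rsub[OF bilinear_G]
  bilinear_lmul[OF bilinear_G] bilinear_rmul[OF bilinear_G]
  bilinear_lneg[OF bilinear_G] bilinear_rneg[OF bilinear_G]

lemma G_eq_0: "x \<in> S \<Longrightarrow> G x v v = 0 \<Longrightarrow> v = 0"
  using inner_form_G[of x] by (auto simp: inner_form_def)

lemma G_eqI:
  assumes "x \<in> S" "\<And>z. G x u z = G x v z"
  shows "u = v"
  using G_eq_0[OF assms(1), of "u - v"] assms by (simp add: G_simps)

lemma differentiable_G: "x \<in> S \<Longrightarrow> (\<lambda>y. G y v w) differentiable at x"
  by (rule smooth_on_differentiable[OF smooth_G open_S])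

lemma orthonormal_frame_G: "x \<in> S \<Longrightarrow> orthonormal_frame (G x) (frame G x)"
  unfolding frame_def by (rule someI_ex[OF orthonormal_frame_exists[OF inner_form_G]])

lemma G_frame: "x \<in> S \<Longrightarrow> G x (frame G x i) (frame G x j) = (if i = j then 1 else 0)"
  using orthonormal_frame_G by (simp add: orthonormal_frame_def)

lemma frame_expansion: "x \<in> S \<Longrightarrow> (\<Sum>i\<in>UNIV. G x v (frame G x i) *\<^sub>R frame G x i) = v"
  using orthonormal_frame_expansion[OF inner_form_G orthonormal_frame_G] by metis

lemma frame_contract:
  assumes "x \<in> S" "linear f"
  shows "(\<Sum>i\<in>UNIV. G x v (frame G x i) * f (frame G x i)) = f v"
proof -
  have "f v = f (\<Sum>i\<in>UNIV. G x v (frame G x i) *\<^sub>R frame G x i)"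
    by (simp add: frame_expansion assms)
  then show ?thesis by (simp add: linear_sum[OF assms(2)] linear_scale[OF assms(2)])
qed

text \<open>A vector known only through its inner products solves a linear system with the Gram
  matrix; Cramer's rule gives its components as quotients of smooth determinants. Both
  \<open>christoffel\<close> and \<open>dual_basis\<close> obtain their smoothness this way.\<close>

lemma smooth_on_representation:
  assumes u: "\<And>x z. x \<in> S \<Longrightarrow> G x (u x) z = F x z" and F: "\<And>z. smooth_on S (\<lambda>x. F x z)"
  shows "smooth_on S u"
proof -
  define M where "M x = (\<chi> i j. G x (axis j 1) (axis i 1))" for x
  have Mv: "(M x *v w) $ i = G x w (axis i 1)" if "x \<in> S" for x w i
  proof -
    have "w = (\<Sum>j\<in>UNIV. (w $ j) *\<^sub>R axis j 1)"
      by (simp add: basis_expansion flip: scalar_mult_eq_scaleR)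
    then have "G x w (axis i 1) = (\<Sum>j\<in>UNIV. (w $ j) * G x (axis j 1) (axis i 1))"
      using inner_form_sum_left[OF inner_form_G[OF that]] by metis
    then show ?thesis by (simp add: M_def matrix_vector_mult_def mult.commute)
  qed
  \<comment> \<open>Positive definiteness: a kernel vector is orthogonal to every axis, hence to
    every z.\<close>
  have det: "det (M x) \<noteq> 0" if x: "x \<in> S" for x
  proof -
    have "w = 0" if w: "M x *v w = 0" for w
    proof (rule G_eqI[OF x])
      fix z :: "real ^ 'n"
      have "z = (\<Sum>j\<in>UNIV. (z $ j) *\<^sub>R axis j 1)"
        by (simp add: basis_expansion flip: scalar_mult_eq_scaleR)
      then have "G x z w = (\<Sum>j\<in>UNIV. (z $ j) * G x (axis j 1) w)"
        using inner_form_sum_left[OF inner_form_G[OF x]] by metis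
      also have "\<dots> = 0" using Mv[OF x, of w] w by (simp add: G_sym[OF x])
      finally show "G x w z = G x 0 z" using G_sym[OF x, of z w] by (simp add: bilinear_lzero[OF bilinear_G[OF x]])
    qed
    then show ?thesis
      by (metis invertible_det_nz invertible_left_inverse matrix_left_invertible_ker)
  qed
  have "u x $ k = det (\<chi> i j. if j = k then F x (axis i 1) else G x (axis j 1) (axis i 1))
      / det (\<chi> i j. G x (axis j 1) (axis i 1))" if x: "x \<in> S" for x k
  proof -
    have "M x *v u x = (\<chi> i. F x (axis i 1))"
      by (simp add: vec_eq_iff Mv[OF x] u[OF x])
    then show ?thesis
      unfolding cramer[OF det[OF x]] by (simp add: M_def cong: if_cong)
  qed
  moreover have "smooth_on S (\<lambda>x. det (\<chi> i j. if j = k then F x (axis i 1) else G x (axis j 1) (axis i 1))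
      / det (\<chi> i j. G x (axis j 1) (axis i 1)))" for k
  proof (intro smooth_on_divide smooth_on_det open_S smooth_G)
    show "smooth_on S (\<lambda>x. if j = k then F x (axis i 1) else G x (axis j 1) (axis i 1))" for i j
      by (cases "j = k") (simp_all add: F smooth_G)
  qed (use det M_def in auto)
  ultimately have "smooth_on S (\<lambda>x. u x $ k)" for k
    using smooth_on_cong[OF open_S] by (metis (no_types, lifting))
  then show ?thesis by (rule smooth_on_vec[OF open_S])
qed

section \<open>Christoffel vectors and metric compatibility\<close>

abbreviation \<Gamma> where "\<Gamma> \<equiv> christoffel G"

lemma linear_dd_G_right: "x \<in> S \<Longrightarrow> linear (\<lambda>w. dd (\<lambda>y. G y v w) x z)"
  by (rule linear_dd_arg[OF open_S]) (auto intro: linear_G_right differentiable_G)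

lemma linear_dd_G_left: "x \<in> S \<Longrightarrow> linear (\<lambda>w. dd (\<lambda>y. G y w v) x z)"
  by (rule linear_dd_arg[OF open_S, of x "\<lambda>y w. G y w v"]) (auto intro: linear_G_left differentiable_G)

lemma linear_dd_G: "x \<in> S \<Longrightarrow> linear (\<lambda>z. dd (\<lambda>y. G y v w) x z)"
  using linear_dd[OF differentiable_G] by blast

lemma dd_G_sym: "x \<in> S \<Longrightarrow> dd (\<lambda>y. G y v w) x z = dd (\<lambda>y. G y w v) x z"
  by (rule dd_cong[OF open_S]) (auto intro: G_sym)

text \<open>The right-hand side is linear in z, so \<open>inner_form_representation\<close>
  validates the definite description; the factor 1/2 adapts it to that lemma.\<close>

lemma koszul:
  assumes "x \<in> S"
  shows "2 * G x (\<Gamma> x v w) z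
    = dd (\<lambda>y. G y w z) x v + dd (\<lambda>y. G y v z) x w - dd (\<lambda>y. G y v w) x z"
proof -
  let ?f = "\<lambda>z. dd (\<lambda>y. G y w z) x v + dd (\<lambda>y. G y v z) x w - dd (\<lambda>y. G y v w) x z"
  have "linear (\<lambda>z. (1/2) * ?f z)"
    using assms
    by (intro linear_mult_right linear_compose_add linear_compose_sub linear_dd_G linear_dd_G_right)
  from inner_form_representation[OF inner_form_G[OF assms] this]
  have "\<exists>!u. \<forall>z. 2 * G x u z = ?f z" by (simp add: field_simps)
  from theI'[OF this] show ?thesis by (simp add: christoffel_def)
qed

text \<open>Torsion-freeness: swapping v and w exchanges the first two terms of
  \<open>koszul\<close> and preserves the third.\<close>

lemma christoffel_sym: "x \<in> S \<Longrightarrow> \<Gamma> x v w = \<Gamma> x w v"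
  by (rule G_eqI, assumption)
    (smt (verit) koszul[of x v w] koszul[of x w v] dd_G_sym[of x v w])

lemma linear_christoffel_right:
  assumes x: "x \<in> S" shows "linear (\<lambda>w. \<Gamma> x v w)"
proof (rule linearI)
  show "\<Gamma> x v (a + b) = \<Gamma> x v a + \<Gamma> x v b" for a b
  proof (rule G_eqI[OF x])
    fix z
    have "2 * G x (\<Gamma> x v (a + b)) z = 2 * G x (\<Gamma> x v a) z + 2 * G x (\<Gamma> x v b) z"
      unfolding koszul[OF x]
      by (simp add: linear_add[OF linear_dd_G_left[OF x]] linear_add[OF linear_dd_G[OF x]]
          linear_add[OF linear_dd_G_right[OF x]])
    then show "G x (\<Gamma> x v (a + b)) z = G x (\<Gamma> x v a + \<Gamma> x v b) z" by (simp add: G_simps[OF x])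
  qed
  show "\<Gamma> x v (r *\<^sub>R a) = r *\<^sub>R \<Gamma> x v a" for r a
  proof (rule G_eqI[OF x])
    fix z
    have "2 * G x (\<Gamma> x v (r *\<^sub>R a)) z = r * (2 * G x (\<Gamma> x v a) z)"
      unfolding koszul[OF x]
      by (simp add: linear_scale[OF linear_dd_G_left[OF x]] linear_scale[OF linear_dd_G[OF x]]
          linear_scale[OF linear_dd_G_right[OF x]] algebra_simps)
    then show "G x (\<Gamma> x v (r *\<^sub>R a)) z = G x (r *\<^sub>R \<Gamma> x v a) z" by (simp add: G_simps[OF x])
  qed
qed

lemma linear_christoffel_left: "x \<in> S \<Longrightarrow> linear (\<lambda>v. \<Gamma> x v w)"
  using linear_christoffel_right[of x w] by (simp add: christoffel_sym[of x _ w])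

lemma smooth_christoffel: "smooth_on S (\<lambda>x. \<Gamma> x v w)"
proof (rule smooth_on_representation)
  show "G x (\<Gamma> x v w) z
      = (1/2) * (dd (\<lambda>y. G y w z) x v + dd (\<lambda>y. G y v z) x w - dd (\<lambda>y. G y v w) x z)"
    if "x \<in> S" for x z using koszul[OF that, of v w z] by simp
  show "smooth_on S (\<lambda>x. (1/2) * (dd (\<lambda>y. G y w z) x v + dd (\<lambda>y. G y v z) x w - dd (\<lambda>y. G y v w) x z))" for z
    by (intro smooth_on_mult smooth_on_add smooth_on_diff smooth_on_dd smooth_G open_S smooth_on_const)
qed

lemma differentiable_christoffel: "x \<in> S \<Longrightarrow> (\<lambda>y. \<Gamma> y v w) differentiable at x"
  by (rule smooth_on_differentiable[OF smooth_christoffel open_S])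

text \<open>Adding \<open>koszul\<close> for (z, v) tested on w and for (z, w) tested on v cancels
  all but the derivative along z.\<close>

lemma metric_compatible:
  "x \<in> S \<Longrightarrow> dd (\<lambda>y. G y v w) x z = G x (\<Gamma> x z v) w + G x v (\<Gamma> x z w)"
  using koszul[of x z v w] koszul[of x z w v] G_sym[of x v "\<Gamma> x z w"] dd_G_sym[of x w v] by simp

lemma smooth_on_G:
  assumes "smooth_on S u" "smooth_on S v"
  shows "smooth_on S (\<lambda>x. G x (u x) (v x))"
proof (rule smooth_on_linear_arg[OF open_S, of "\<lambda>x w. G x (u x) w"])
  show "smooth_on S (\<lambda>x. G x (u x) w)" for w
    by (rule smooth_on_linear_arg[OF open_S, of "\<lambda>x v. G x v w"])
      (auto intro: linear_G_left smooth_G assms)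
qed (auto intro: linear_G_right assms)

lemma dd_G:
  assumes x: "x \<in> S" and u: "smooth_on S u" and v: "smooth_on S v"
  shows "dd (\<lambda>y. G y (u y) (v y)) x z
    = dd (\<lambda>y. G y (u x) (v x)) x z + G x (dd u x z) (v x) + G x (u x) (dd v x z)"
proof -
  note d = smooth_on_differentiable[OF _ open_S x]
  have "dd (\<lambda>y. G y (u y) (v y)) x z = dd (\<lambda>y. G y (u y) (v x)) x z + G x (u x) (dd v x z)"
    by (rule dd_linear_arg[OF open_S x, of "\<lambda>y w. G y (u y) w"])
      (auto intro!: d smooth_on_G u v linear_G_right)
  also have "dd (\<lambda>y. G y (u y) (v x)) x z = dd (\<lambda>y. G y (u x) (v x)) x z + G x (dd u x z) (v x)"
    by (rule dd_linear_arg[OF open_S x, of "\<lambda>y w. G y w (v x)"])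
      (auto intro!: d smooth_G u v linear_G_left)
  finally show ?thesis by simp
qed

text \<open>The frame is an arbitrary choice at each point and need not depend smoothly on the point.
  Traces are therefore differentiated in the constant basis \<open>axis a 1\<close> and its metric dual, in the
  manner of contracting with \<open>g\<^sup>a\<^sup>b\<close>.\<close>

definition dual_basis :: "real ^ 'n \<Rightarrow> 'n \<Rightarrow> real ^ 'n" where
  "dual_basis x a = (\<Sum>i\<in>UNIV. (frame G x i $ a) *\<^sub>R frame G x i)"

text \<open>Characterises \<open>dual_basis x a\<close> as the coordinate differential with index a,
  raised by the metric. The choice of frame drops out, and smoothness follows.\<close>

lemma G_dual_basis: "x \<in> S \<Longrightarrow> G x (dual_basis x a) z = z $ a"
  using frame_contract[of x "\<lambda>v. v $ a" z] bounded_linear_vec_nth[THEN bounded_linear.linear, of a]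
  by (simp add: dual_basis_def inner_form_sum_left[OF inner_form_G] G_sym[of x _ z] mult.commute)

lemma smooth_dual_basis: "smooth_on S (\<lambda>x. dual_basis x a)"
  by (rule smooth_on_representation[OF G_dual_basis]) auto

text \<open>Expanding the frame vector in the first slot along the axes and moving its coefficients
  to the second slot turns the frame sum there into \<open>dual_basis\<close>.\<close>

lemma frame_trace:
  assumes "x \<in> S" "bilinear T"
  shows "(\<Sum>i\<in>UNIV. T (frame G x i) (frame G x i)) = (\<Sum>a\<in>UNIV. T (axis a 1) (dual_basis x a))"
proof -
  have l: "linear (T v)" "linear (\<lambda>v. T v w)" for v w
    using assms(2) by (auto simp: bilinear_def)
  let ?e = "frame G x"
  have "(\<Sum>a\<in>UNIV. T (axis a 1) (dual_basis x a))
      = (\<Sum>a\<in>UNIV. \<Sum>i\<in>UNIV. T ((?e i $ a) *\<^sub>R axis a 1) (?e i))"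
    by (simp add: dual_basis_def linear_sum[OF l(1)] linear_scale[OF l(1)] linear_scale[OF l(2)])
  also have "\<dots> = (\<Sum>i\<in>UNIV. T (\<Sum>a\<in>UNIV. (?e i $ a) *\<^sub>R axis a 1) (?e i))"
    by (subst sum.swap) (simp add: linear_sum[OF l(2)])
  finally show ?thesis by (simp add: basis_expansion flip: scalar_mult_eq_scaleR)
qed

text \<open>Comes from differentiating the constant function \<open>G y (dual_basis y a) w\<close>.
  The first term is due to the varying metric, the second is the covariant derivative of the
  coordinate differential with its index raised.\<close>

lemma dd_dual_basis:
  assumes x: "x \<in> S"
  shows "dd (\<lambda>y. dual_basis y a) x z
    = - \<Gamma> x z (dual_basis x a) - (\<Sum>c\<in>UNIV. (\<Gamma> x z (axis c 1) $ a) *\<^sub>R dual_basis x c)"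
proof (rule G_eqI[OF x])
  fix w :: "real ^ 'n"
  have "dd (\<lambda>y. G y (dual_basis y a) w) x z = dd (\<lambda>y. w $ a) x z"
    by (rule dd_cong[OF open_S x]) (simp add: G_dual_basis)
  then have 1: "G x (dd (\<lambda>y. dual_basis y a) x z) w
      = - G x (\<Gamma> x z (dual_basis x a)) w - \<Gamma> x z w $ a"
    using dd_G[OF x smooth_dual_basis smooth_on_const, of a w z]
      metric_compatible[OF x, of "dual_basis x a" w z] G_dual_basis[OF x, of a "\<Gamma> x z w"]
      linear_0[OF linear_G_right[OF x]] by simp
  have "w = (\<Sum>c\<in>UNIV. (w $ c) *\<^sub>R axis c 1)"
    by (simp add: basis_expansion flip: scalar_mult_eq_scaleR)
  then have "\<Gamma> x z w = \<Gamma> x z (\<Sum>c\<in>UNIV. (w $ c) *\<^sub>R axis c 1)" by (rule arg_cong)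
  also have "\<dots> = (\<Sum>c\<in>UNIV. (w $ c) *\<^sub>R \<Gamma> x z (axis c 1))"
    by (simp add: linear_sum[OF linear_christoffel_right[OF x]] linear_scale[OF linear_christoffel_right[OF x]])
  finally have "\<Gamma> x z w $ a = (\<Sum>c\<in>UNIV. w $ c * (\<Gamma> x z (axis c 1) $ a))" by simp
  also have "\<dots> = G x (\<Sum>c\<in>UNIV. (\<Gamma> x z (axis c 1) $ a) *\<^sub>R dual_basis x c) w"
    unfolding inner_form_sum_left[OF inner_form_G[OF x]]
    by (intro sum.cong refl) (simp add: G_dual_basis[OF x])
  finally show "G x (dd (\<lambda>y. dual_basis y a) x z) w = G x (- \<Gamma> x z (dual_basis x a)
      - (\<Sum>c\<in>UNIV. (\<Gamma> x z (axis c 1) $ a) *\<^sub>R dual_basis x c)) w"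
    using 1 by (simp add: G_simps[OF x])
qed

lemma smooth_frame_trace:
  assumes "\<And>y. y \<in> S \<Longrightarrow> bilinear (T y)" "\<And>v w. smooth_on S (\<lambda>y. T y v w)"
  shows "smooth_on S (\<lambda>y. \<Sum>i\<in>UNIV. T y (frame G y i) (frame G y i))"
proof -
  have "smooth_on S (\<lambda>y. T y (axis a 1) (dual_basis y a))" for a
    by (rule smooth_on_linear_arg[OF open_S, of "\<lambda>y. T y (axis a 1)"])
      (use assms smooth_dual_basis in \<open>auto simp: bilinear_def\<close>)
  then have "smooth_on S (\<lambda>y. \<Sum>a\<in>UNIV. T y (axis a 1) (dual_basis y a))"
    by (intro smooth_on_sum open_S)
  then show ?thesis
    by (rule smooth_on_cong[OF open_S, THEN iffD2, rotated]) (rule frame_trace[OF _ assms(1)])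
qed

text \<open>Contraction commutes with covariant differentiation. On the right the frame is frozen at
  x, so its dependence on the point never matters; both Christoffel terms come from
  \<open>dd_dual_basis\<close>.\<close>

lemma dd_frame_trace:
  fixes T :: "real ^ 'n \<Rightarrow> real ^ 'n \<Rightarrow> real ^ 'n \<Rightarrow> real"
  assumes x: "x \<in> S" and T: "\<And>y. y \<in> S \<Longrightarrow> bilinear (T y)" "\<And>v w. smooth_on S (\<lambda>y. T y v w)"
  shows "dd (\<lambda>y. \<Sum>i\<in>UNIV. T y (frame G y i) (frame G y i)) x z
    = (\<Sum>i\<in>UNIV. dd (\<lambda>y. T y (frame G x i) (frame G x i)) x z
        - T x (\<Gamma> x z (frame G x i)) (frame G x i) - T x (frame G x i) (\<Gamma> x z (frame G x i)))"
proof -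
  have l: "linear (T y v)" "linear (\<lambda>v. T y v w)" if "y \<in> S" for y v w
    using T(1)[OF that] by (auto simp: bilinear_def)
  have d: "(\<lambda>y. T y v w) differentiable at x" for v w
    by (rule smooth_on_differentiable[OF T(2) open_S x])
  let ?d = "dual_basis x" and ?D = "\<lambda>v w. dd (\<lambda>y. T y v w) x z"
  \<comment> \<open>The covariant derivative is again bilinear, so \<open>frame_trace\<close> can
    lead from the coordinate basis back to the frame at x.\<close>
  have bil: "bilinear (\<lambda>v w. ?D v w - T x (\<Gamma> x z v) w - T x v (\<Gamma> x z w))"
    unfolding bilinear_def
  proof (intro conjI allI linear_compose_sub)
    show "linear (\<lambda>w. ?D v w)" for v
      by (rule linear_dd_arg[OF open_S x, of "\<lambda>y w. T y v w"]) (use l d in auto)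
    show "linear (\<lambda>v. ?D v w)" for w
      by (rule linear_dd_arg[OF open_S x, of "\<lambda>y v. T y v w"]) (use l d in auto)
    show "linear (\<lambda>v. T x (\<Gamma> x z v) w)" for w
      by (rule linear_compose'[OF linear_christoffel_right[OF x] l(2)[OF x]])
    show "linear (\<lambda>w. T x v (\<Gamma> x z w))" for v
      by (rule linear_compose'[OF linear_christoffel_right[OF x] l(1)[OF x]])
  qed (use l x in auto)
  have s: "smooth_on S (\<lambda>y. T y (axis a 1) (dual_basis y a))" for a
    by (rule smooth_on_linear_arg[OF open_S, of "\<lambda>y. T y (axis a 1)"])
      (use l T smooth_dual_basis in auto)
  have "dd (\<lambda>y. \<Sum>i\<in>UNIV. T y (frame G y i) (frame G y i)) x z
      = dd (\<lambda>y. \<Sum>a\<in>UNIV. T y (axis a 1) (dual_basis y a)) x z"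
    by (rule dd_cong[OF open_S x]) (auto intro: frame_trace T)
  also have "\<dots> = (\<Sum>a\<in>UNIV. dd (\<lambda>y. T y (axis a 1) (dual_basis y a)) x z)"
    by (intro dd_sum smooth_on_differentiable[OF s open_S x])
  also have "\<dots> = (\<Sum>a\<in>UNIV. ?D (axis a 1) (?d a) + T x (axis a 1) (dd (\<lambda>y. dual_basis y a) x z))"
    by (intro sum.cong refl dd_linear_arg[OF open_S x])
      (use l d smooth_on_differentiable[OF smooth_dual_basis open_S x] in auto)
  also have "\<dots> = (\<Sum>a\<in>UNIV. ?D (axis a 1) (?d a) - T x (axis a 1) (\<Gamma> x z (?d a))
      - (\<Sum>c\<in>UNIV. (\<Gamma> x z (axis c 1) $ a) * T x (axis a 1) (?d c)))"
    by (simp add: dd_dual_basis[OF x] linear_diff[OF l(1)[OF x]] linear_neg[OF l(1)[OF x]]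
        linear_sum[OF l(1)[OF x]] linear_scale[OF l(1)[OF x]] algebra_simps)
  \<comment> \<open>Exchanging the sums gathers the components of
    \<open>\<Gamma> x z (axis c 1)\<close> in the first slot, which produces the other Christoffel
    term.\<close>
  also have "\<dots> = (\<Sum>a\<in>UNIV. ?D (axis a 1) (?d a) - T x (axis a 1) (\<Gamma> x z (?d a)))
      - (\<Sum>c\<in>UNIV. \<Sum>a\<in>UNIV. (\<Gamma> x z (axis c 1) $ a) * T x (axis a 1) (?d c))"
    by (subst sum.swap[of "\<lambda>c a. (\<Gamma> x z (axis c 1) $ a) * T x (axis a 1) (?d c)"])
      (simp add: sum_subtractf)
  also have "(\<Sum>c\<in>UNIV. \<Sum>a\<in>UNIV. (\<Gamma> x z (axis c 1) $ a) * T x (axis a 1) (?d c))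
      = (\<Sum>c\<in>UNIV. T x (\<Gamma> x z (axis c 1)) (?d c))"
  proof (rule sum.cong[OF refl])
    fix c
    have "T x (\<Sum>a\<in>UNIV. (\<Gamma> x z (axis c 1) $ a) *\<^sub>R axis a 1) (?d c)
        = (\<Sum>a\<in>UNIV. (\<Gamma> x z (axis c 1) $ a) * T x (axis a 1) (?d c))"
      by (simp add: linear_sum[OF l(2)[OF x]] linear_scale[OF l(2)[OF x]])
    then show "(\<Sum>a\<in>UNIV. (\<Gamma> x z (axis c 1) $ a) * T x (axis a 1) (?d c)) = T x (\<Gamma> x z (axis c 1)) (?d c)"
      by (simp add: basis_expansion flip: scalar_mult_eq_scaleR)
  qed
  finally show ?thesis
    using frame_trace[OF x bil] by (simp add: sum_subtractf)
qed

end

section \<open>The Bach tensor is trace-free\<close>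

lemma linear_divide: "linear f \<Longrightarrow> linear (\<lambda>x. f x / c :: real)"
  using linear_mult_left[of f "inverse c"] by (simp add: divide_inverse)

definition multilinear4 :: "('v::real_vector \<Rightarrow> 'v \<Rightarrow> 'v \<Rightarrow> 'v \<Rightarrow> real) \<Rightarrow> bool" where
  "multilinear4 T \<longleftrightarrow>
     (\<forall>b c d. linear (\<lambda>a. T a b c d)) \<and> (\<forall>a c d. linear (\<lambda>b. T a b c d)) \<and>
     (\<forall>a b d. linear (\<lambda>c. T a b c d)) \<and> (\<forall>a b c. linear (\<lambda>d. T a b c d))"

lemma multilinear4_add:
  "multilinear4 T \<Longrightarrow> multilinear4 U \<Longrightarrow> multilinear4 (\<lambda>a b c d. T a b c d + U a b c d)"
  by (simp add: multilinear4_def linear_compose_add)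

lemma multilinear4_diff:
  "multilinear4 T \<Longrightarrow> multilinear4 U \<Longrightarrow> multilinear4 (\<lambda>a b c d. T a b c d - U a b c d)"
  by (simp add: multilinear4_def linear_compose_sub)

lemma multilinear4_mult: "multilinear4 T \<Longrightarrow> multilinear4 (\<lambda>a b c d. r * T a b c d)"
  by (simp add: multilinear4_def linear_mult_right)

lemma multilinear4_kulkarni_nomizu:
  assumes "bilinear h" "bilinear k"
  shows "multilinear4 (kulkarni_nomizu h k)"
  using assms unfolding multilinear4_def kulkarni_nomizu_def bilinear_def
  by (intro conjI allI linear_divide linear_compose_sub linear_compose_add
      linear_mult_left linear_mult_right) auto

context chart_metric
begin

text \<open>Constant fields commute, so the bracket term is \<open>christoffel\<close> at the zero
  vector and vanishes.\<close>

lemma curvature_eq: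
  assumes "x \<in> S"
  shows "curvature G (\<lambda>_. X) (\<lambda>_. Y) (\<lambda>_. Z) x
    = dd (\<lambda>y. \<Gamma> y Y Z) x X - dd (\<lambda>y. \<Gamma> y X Z) x Y + \<Gamma> x X (\<Gamma> x Y Z) - \<Gamma> x Y (\<Gamma> x X Z)"
  using linear_0[OF linear_christoffel_left[OF assms]]
  by (simp add: curvature_def nabla_def[abs_def] lie_bracket_def)

lemma linear_dd_christoffel: "x \<in> S \<Longrightarrow> linear (\<lambda>z. dd (\<lambda>y. \<Gamma> y v w) x z)"
  using linear_dd[OF differentiable_christoffel] by blast

lemma linear_dd_christoffel_left: "x \<in> S \<Longrightarrow> linear (\<lambda>v. dd (\<lambda>y. \<Gamma> y v w) x z)"
  by (rule linear_dd_arg[OF open_S, of x "\<lambda>y v. \<Gamma> y v w"])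
    (auto intro: linear_christoffel_left differentiable_christoffel)

lemma linear_dd_christoffel_right: "x \<in> S \<Longrightarrow> linear (\<lambda>w. dd (\<lambda>y. \<Gamma> y v w) x z)"
  by (rule linear_dd_arg[OF open_S, of x "\<lambda>y w. \<Gamma> y v w"])
    (auto intro: linear_christoffel_right differentiable_christoffel)

lemma multilinear4_riemann:
  assumes x: "x \<in> S"
  shows "multilinear4 (riemann G x)"
proof -
  note 1 = linear_christoffel_left[OF x] and 2 = linear_christoffel_right[OF x]
  have 3: "linear (\<lambda>v. \<Gamma> x a (\<Gamma> x v b))" "linear (\<lambda>v. \<Gamma> x a (\<Gamma> x b v))" for a b
    by (rule linear_compose'[OF 1 2], rule linear_compose'[OF 2 2])
  have "linear (\<lambda>X. curvature G (\<lambda>_. X) (\<lambda>_. Y) (\<lambda>_. Z) x)"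
    "linear (\<lambda>Y. curvature G (\<lambda>_. X) (\<lambda>_. Y) (\<lambda>_. Z) x)"
    "linear (\<lambda>Z. curvature G (\<lambda>_. X) (\<lambda>_. Y) (\<lambda>_. Z) x)" for X Y Z
    unfolding curvature_eq[OF x]
    by (intro linear_compose_add linear_compose_sub linear_dd_christoffel[OF x]
        linear_dd_christoffel_left[OF x] linear_dd_christoffel_right[OF x] 1 2 3)+
  then show ?thesis
    unfolding multilinear4_def riemann_def
    by (intro conjI allI linear_G_right[OF x] linear_compose'[OF _ linear_G_left[OF x]])
qed

lemma smooth_christoffel_arg: "smooth_on S u \<Longrightarrow> smooth_on S (\<lambda>x. \<Gamma> x v (u x))"
  by (rule smooth_on_linear_arg[OF open_S]) (auto intro: linear_christoffel_right smooth_christoffel)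

lemma smooth_riemann: "smooth_on S (\<lambda>x. riemann G x X Y Z U)"
proof -
  have "smooth_on S (\<lambda>x. G x (dd (\<lambda>y. \<Gamma> y Y Z) x X - dd (\<lambda>y. \<Gamma> y X Z) x Y
      + \<Gamma> x X (\<Gamma> x Y Z) - \<Gamma> x Y (\<Gamma> x X Z)) U)"
    by (intro smooth_on_G smooth_on_add smooth_on_diff smooth_on_dd smooth_christoffel
        smooth_christoffel_arg open_S smooth_on_const)
  then show ?thesis
    by (rule smooth_on_cong[OF open_S, THEN iffD2, rotated]) (simp add: riemann_def curvature_eq)
qed

lemma bilinear_riemann_outer: "x \<in> S \<Longrightarrow> bilinear (\<lambda>v w. riemann G x v X Y w)"
  using multilinear4_riemann by (auto simp: multilinear4_def bilinear_def)

lemma bilinear_ricci: "x \<in> S \<Longrightarrow> bilinear (ricci G x)"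
  unfolding ricci_def[abs_def]
  by (rule bilinear_sum) (use multilinear4_riemann in \<open>auto simp: multilinear4_def bilinear_def\<close>)

lemma smooth_ricci: "smooth_on S (\<lambda>x. ricci G x X Y)"
  unfolding ricci_def
  by (rule smooth_frame_trace[of "\<lambda>x v w. riemann G x v X Y w"])
    (auto intro: bilinear_riemann_outer smooth_riemann)

lemma smooth_scalar_curvature: "smooth_on S (\<lambda>x. scalar_curvature G x)"
  unfolding scalar_curvature_def
  by (rule smooth_frame_trace) (auto intro: bilinear_ricci smooth_ricci)

lemma multilinear4_weyl: "x \<in> S \<Longrightarrow> multilinear4 (weyl G x)"
  unfolding weyl_def[abs_def] Let_def
  by (intro multilinear4_add multilinear4_diff multilinear4_mult multilinear4_riemann
      multilinear4_kulkarni_nomizu bilinear_ricci bilinear_G)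

lemma smooth_weyl: "smooth_on S (\<lambda>x. weyl G x X Y Z U)"
  unfolding weyl_def Let_def kulkarni_nomizu_def divide_inverse
  by (intro smooth_on_add smooth_on_diff smooth_on_mult smooth_riemann smooth_ricci smooth_G
      smooth_scalar_curvature open_S smooth_on_const)

lemma trace_G: "x \<in> S \<Longrightarrow> (\<Sum>i\<in>UNIV. G x (frame G x i) (frame G x i)) = real CARD('n)"
  by (simp add: G_frame)

text \<open>Of the four terms two contain a full trace and two collapse to \<open>h Y Z\<close> by
  \<open>frame_contract\<close>; hence the coefficient n - 2.\<close>

lemma trace_kulkarni_nomizu:
  assumes x: "x \<in> S" and h: "bilinear h"
  shows "(\<Sum>i\<in>UNIV. kulkarni_nomizu h (G x) (frame G x i) Y Z (frame G x i))
    = ((\<Sum>i\<in>UNIV. h (frame G x i) (frame G x i)) * G x Y Z + (real CARD('n) - 2) * h Y Z) / 2"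
proof -
  let ?e = "frame G x"
  have l: "linear (\<lambda>v. h v w)" "linear (h v)" for v w
    using h by (auto simp: bilinear_def)
  have "(\<Sum>i\<in>UNIV. h (?e i) Z * G x Y (?e i)) = h Y Z"
    using frame_contract[OF x l(1), of Y Z] by (simp add: mult.commute)
  moreover have "(\<Sum>i\<in>UNIV. h Y (?e i) * G x (?e i) Z) = h Y Z"
    using frame_contract[OF x l(2), of Z Y] by (simp add: G_sym[OF x, of _ Z] mult.commute)
  ultimately show ?thesis
    by (simp add: kulkarni_nomizu_def sum_divide_distrib[symmetric] sum.distrib sum_subtractf
        sum_distrib_left[symmetric] sum_distrib_right[symmetric] trace_G[OF x] G_frame[OF x] algebra_simps)
qed

text \<open>The Ricci product contributes -S - r g/(n - 2) to the trace, the metric product r g/(n -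
  2). The outer slots are contracted because \<open>bach\<close> puts its arguments X and Y
  there.\<close>

lemma trace_weyl:
  assumes x: "x \<in> S" and n: "CARD('n) \<ge> 3"
  shows "(\<Sum>i\<in>UNIV. weyl G x (frame G x i) Y Z (frame G x i)) = 0"
proof -
  let ?n = "real CARD('n)" and ?r = "scalar_curvature G x"
  have n': "?n - 1 \<noteq> 0" "?n - 2 \<noteq> 0" using n by linarith+
  have "(\<Sum>i\<in>UNIV. weyl G x (frame G x i) Y Z (frame G x i))
      = ricci G x Y Z
        - 2 / (?n - 2) * (\<Sum>i\<in>UNIV. kulkarni_nomizu (ricci G x) (G x) (frame G x i) Y Z (frame G x i))
        + ?r / ((?n - 1) * (?n - 2))
          * (\<Sum>i\<in>UNIV. kulkarni_nomizu (G x) (G x) (frame G x i) Y Z (frame G x i))"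
    by (simp only: weyl_def Let_def ricci_def sum.distrib sum_subtractf sum_distrib_left)
  also have "\<dots> = ricci G x Y Z - 2 / (?n - 2) * ((?r * G x Y Z + (?n - 2) * ricci G x Y Z) / 2)
        + ?r / ((?n - 1) * (?n - 2)) * ((?n * G x Y Z + (?n - 2) * G x Y Z) / 2)"
    by (simp only: trace_kulkarni_nomizu[OF x bilinear_ricci[OF x]]
        trace_kulkarni_nomizu[OF x bilinear_G[OF x]] scalar_curvature_def trace_G[OF x])
  also have "\<dots> = 0"
    using n' by (simp add: divide_simps) (simp add: algebra_simps)
  finally show ?thesis .
qed

text \<open>The trace vanishes on all of S, not just at x, so its derivative vanishes too.\<close>

lemma trace_free_covariant:
  assumes x: "x \<in> S" and T: "\<And>y. y \<in> S \<Longrightarrow> bilinear (T y)" "\<And>v w. smooth_on S (\<lambda>y. T y v w)"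
    and 0: "\<And>y. y \<in> S \<Longrightarrow> (\<Sum>i\<in>UNIV. T y (frame G y i) (frame G y i)) = 0"
  shows "(\<Sum>i\<in>UNIV. dd (\<lambda>y. T y (frame G x i) (frame G x i)) x z
        - T x (\<Gamma> x z (frame G x i)) (frame G x i) - T x (frame G x i) (\<Gamma> x z (frame G x i))) = (0::real)"
proof -
  have "dd (\<lambda>y. \<Sum>i\<in>UNIV. T y (frame G y i) (frame G y i)) x z = dd (\<lambda>_. 0) x z"
    by (rule dd_cong[OF open_S x]) (rule 0)
  then show ?thesis using dd_frame_trace[OF x T] by simp
qed

section \<open>Covariant derivatives of a rank four tensor with vanishing outer trace\<close>

lemma covd_4:
  "covd G W x [p, a, b, c, d] = dd (\<lambda>y. W y [a, b, c, d]) x p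
     - W x [\<Gamma> x p a, b, c, d] - W x [a, \<Gamma> x p b, c, d]
     - W x [a, b, \<Gamma> x p c, d] - W x [a, b, c, \<Gamma> x p d]"
  by (simp add: covd_def lessThan_Suc eval_nat_numeral)

lemma covd_5:
  "covd G W x [q, p, a, b, c, d] = dd (\<lambda>y. W y [p, a, b, c, d]) x q - W x [\<Gamma> x q p, a, b, c, d]
     - W x [p, \<Gamma> x q a, b, c, d] - W x [p, a, \<Gamma> x q b, c, d]
     - W x [p, a, b, \<Gamma> x q c, d] - W x [p, a, b, c, \<Gamma> x q d]"
  by (simp add: covd_def lessThan_Suc eval_nat_numeral)

context
  fixes T :: "real ^ 'n \<Rightarrow> real ^ 'n \<Rightarrow> real ^ 'n \<Rightarrow> real ^ 'n \<Rightarrow> real ^ 'n \<Rightarrow> real"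
  assumes multilinear4_T: "\<And>y. y \<in> S \<Longrightarrow> multilinear4 (T y)"
    and smooth_T: "\<And>a b c d. smooth_on S (\<lambda>y. T y a b c d)"
    and trace_T: "\<And>y b c. y \<in> S \<Longrightarrow> (\<Sum>i\<in>UNIV. T y (frame G y i) b c (frame G y i)) = 0"
begin

abbreviation TL :: "real ^ 'n \<Rightarrow> (real ^ 'n) list \<Rightarrow> real" where
  "TL \<equiv> \<lambda>y ws. T y (ws ! 0) (ws ! 1) (ws ! 2) (ws ! 3)"

lemma covd_TL:
  "covd G TL x [p, a, b, c, d] = dd (\<lambda>y. T y a b c d) x p
     - T x (\<Gamma> x p a) b c d - T x a (\<Gamma> x p b) c d - T x a b (\<Gamma> x p c) d - T x a b c (\<Gamma> x p d)"
  by (simp add: covd_4)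

lemma linear_T:
  assumes "y \<in> S"
  shows "linear (\<lambda>a. T y a b c d)" "linear (\<lambda>b. T y a b c d)"
    "linear (\<lambda>c. T y a b c d)" "linear (\<lambda>d. T y a b c d)"
  using multilinear4_T[OF assms] by (auto simp: multilinear4_def)

lemma bilinear_covd_TL:
  assumes x: "x \<in> S"
  shows "bilinear (\<lambda>a d. covd G TL x [p, a, b, c, d])"
  unfolding covd_TL bilinear_def
proof (intro conjI allI linear_compose_sub linear_T[OF x])
  note d = smooth_on_differentiable[OF smooth_T open_S x]
  show "linear (\<lambda>d. dd (\<lambda>y. T y a b c d) x p)" for a
    by (rule linear_dd_arg[OF open_S x, of "\<lambda>y. T y a b c"]) (auto intro: linear_T d)
  show "linear (\<lambda>a. dd (\<lambda>y. T y a b c d) x p)" for d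
    by (rule linear_dd_arg[OF open_S x, of "\<lambda>y a. T y a b c d"]) (auto intro: linear_T d)
  show "linear (\<lambda>a. T x (\<Gamma> x p a) b c d)" "linear (\<lambda>d. T x a b c (\<Gamma> x p d))" for a d
    by (rule linear_compose'[OF linear_christoffel_right[OF x]], rule linear_T[OF x])+
qed

lemma smooth_covd_TL: "smooth_on S (\<lambda>x. covd G TL x [p, a, b, c, d])"
  unfolding covd_TL
proof (intro smooth_on_diff open_S smooth_on_dd smooth_T)
  show "smooth_on S (\<lambda>x. T x (\<Gamma> x p a) b c d)"
    by (rule smooth_on_linear_arg[OF open_S, of "\<lambda>x v. T x v b c d"])
      (auto intro: linear_T smooth_T smooth_christoffel)
  show "smooth_on S (\<lambda>x. T x a (\<Gamma> x p b) c d)"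
    by (rule smooth_on_linear_arg[OF open_S, of "\<lambda>x v. T x a v c d"])
      (auto intro: linear_T smooth_T smooth_christoffel)
  show "smooth_on S (\<lambda>x. T x a b (\<Gamma> x p c) d)"
    by (rule smooth_on_linear_arg[OF open_S, of "\<lambda>x v. T x a b v d"])
      (auto intro: linear_T smooth_T smooth_christoffel)
  show "smooth_on S (\<lambda>x. T x a b c (\<Gamma> x p d))"
    by (rule smooth_on_linear_arg[OF open_S, of "\<lambda>x v. T x a b c v"])
      (auto intro: linear_T smooth_T smooth_christoffel)
qed

text \<open>The Christoffel terms in the inner slots are traces of T with other inner arguments and
  vanish; what remains is the covariant derivative of the form in the outer slots.\<close>

lemma trace_covd_TL:
  assumes x: "x \<in> S"
  shows "(\<Sum>i\<in>UNIV. covd G TL x [p, frame G x i, b, c, frame G x i]) = 0"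
proof -
  have "(\<Sum>i\<in>UNIV. dd (\<lambda>y. T y (frame G x i) b c (frame G x i)) x p
        - T x (\<Gamma> x p (frame G x i)) b c (frame G x i) - T x (frame G x i) b c (\<Gamma> x p (frame G x i))) = 0"
    by (rule trace_free_covariant[OF x, of "\<lambda>y v w. T y v b c w"])
      (auto simp: bilinear_def smooth_T trace_T linear_T)
  then show ?thesis
    unfolding covd_TL using trace_T[OF x] by (simp add: sum_subtractf)
qed

text \<open>The same argument one level up, with the first covariant derivative in place of T; the
  correction in its direction slot p is again a vanishing trace.\<close>

lemma trace_covd_covd_TL:
  assumes x: "x \<in> S"
  shows "(\<Sum>i\<in>UNIV. covd G (covd G TL) x [q, p, frame G x i, b, c, frame G x i]) = 0"
proof -
  have "(\<Sum>i\<in>UNIV. dd (\<lambda>y. covd G TL y [p, frame G x i, b, c, frame G x i]) x q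
        - covd G TL x [p, \<Gamma> x q (frame G x i), b, c, frame G x i]
        - covd G TL x [p, frame G x i, b, c, \<Gamma> x q (frame G x i)]) = 0"
    by (rule trace_free_covariant[OF x, of "\<lambda>y v w. covd G TL y [p, v, b, c, w]"])
      (rule bilinear_covd_TL smooth_covd_TL trace_covd_TL; assumption?)+
  then show ?thesis
    unfolding covd_5[of "covd G TL"] using trace_covd_TL[OF x] by (simp add: sum_subtractf)
qed

end

text \<open>With the sum over k moved innermost, both double sums vanish term by term for each i and
  j.\<close>

lemma trace_bach:
  assumes x: "x \<in> S" and n: "CARD('n) \<ge> 3"
  shows "(\<Sum>k\<in>UNIV. bach G x (frame G x k) (frame G x k)) = 0"
proof -
  let ?e = "frame G x" and ?W = "\<lambda>y ws. weyl G y (ws ! 0) (ws ! 1) (ws ! 2) (ws ! 3)"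
  have "(\<Sum>k\<in>UNIV. \<Sum>i\<in>UNIV. \<Sum>j\<in>UNIV. covd G (covd G ?W) x [?e i, ?e j, ?e k, ?e i, ?e j, ?e k])
      = (\<Sum>i\<in>UNIV. \<Sum>j\<in>UNIV. \<Sum>k\<in>UNIV. covd G (covd G ?W) x [?e i, ?e j, ?e k, ?e i, ?e j, ?e k])"
    by (subst sum.swap, rule sum.cong[OF refl], rule sum.swap)
  also have "\<dots> = 0"
    by (simp only: trace_covd_covd_TL[OF multilinear4_weyl smooth_weyl trace_weyl[OF _ n] x] sum.neutral_const)
  finally have 1: "(\<Sum>k\<in>UNIV. \<Sum>i\<in>UNIV. \<Sum>j\<in>UNIV.
    covd G (covd G ?W) x [?e i, ?e j, ?e k, ?e i, ?e j, ?e k]) = 0" .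
  have "(\<Sum>k\<in>UNIV. \<Sum>i\<in>UNIV. \<Sum>j\<in>UNIV. ricci G x (?e i) (?e j) * weyl G x (?e k) (?e i) (?e j) (?e k))
      = (\<Sum>i\<in>UNIV. \<Sum>j\<in>UNIV. \<Sum>k\<in>UNIV. ricci G x (?e i) (?e j) * weyl G x (?e k) (?e i) (?e j) (?e k))"
    by (subst sum.swap, rule sum.cong[OF refl], rule sum.swap)
  also have "\<dots> = 0"
    by (simp add: sum_distrib_left[symmetric] trace_weyl[OF x n])
  finally show ?thesis
    using 1 by (simp add: bach_def Let_def sum.distrib flip: sum_distrib_left sum_divide_distrib)
qed

end

section \<open>Projective fields\<close>

lemma dd_minus: "f differentiable at x \<Longrightarrow> dd (\<lambda>y. - f y) x v = - dd f x v"
  using dd_diff[of "\<lambda>_. 0" x f v] by simp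

context chart_metric
begin

text \<open>For a constant field X the bracket of V with X is minus the derivative of V along X,
  which turns both minus signs into plus.\<close>

lemma lie_metric_eq:
  "x \<in> S \<Longrightarrow> lie_metric V G x X Y
     = dd (\<lambda>y. G y X Y) x (V x) + G x (dd V x X) Y + G x X (dd V x Y)"
  by (simp add: lie_metric_def lie_bracket_def G_simps)

context
  fixes V :: "real ^ 'n \<Rightarrow> real ^ 'n"
  assumes smooth_V: "smooth_on S V"
begin

lemma differentiable_V: "x \<in> S \<Longrightarrow> V differentiable at x"
  by (rule smooth_on_differentiable[OF smooth_V open_S])

lemma differentiable_dd_V: "x \<in> S \<Longrightarrow> (\<lambda>y. dd V y X) differentiable at x"
  by (rule smooth_on_differentiable[OF smooth_on_dd[OF smooth_V] open_S])

lemma lie_connection_eq: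
  assumes x: "x \<in> S"
  shows "lie_connection V G (\<lambda>_. X) (\<lambda>_. Y) x = dd (\<lambda>y. \<Gamma> y X Y) x (V x) - dd V x (\<Gamma> x X Y)
     + \<Gamma> x (dd V x X) Y + dd (\<lambda>y. dd V y Y) x X + \<Gamma> x X (dd V x Y)"
  by (simp add: lie_connection_def nabla_def[abs_def] lie_bracket_def[abs_def]
      dd_minus[OF differentiable_dd_V[OF x]] linear_neg[OF linear_christoffel_left[OF x]]
      linear_neg[OF linear_christoffel_right[OF x]])

lemma bilinear_lie_metric:
  assumes x: "x \<in> S"
  shows "bilinear (lie_metric V G x)"
  unfolding bilinear_def lie_metric_eq[OF x]
proof (intro conjI allI linear_compose_add linear_dd_G_left linear_dd_G_right linear_G_left linear_G_right x)
  note d = linear_dd[OF differentiable_V[OF x]]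
  show "linear (\<lambda>X. G x (dd V x X) Y)" "linear (\<lambda>X. G x Y (dd V x X))" for Y
    by (rule linear_compose'[OF d linear_G_left[OF x]], rule linear_compose'[OF d linear_G_right[OF x]])
qed

lemma smooth_lie_metric: "smooth_on S (\<lambda>x. lie_metric V G x X Y)"
proof -
  have "smooth_on S (\<lambda>x. dd (\<lambda>y. G y X Y) x (V x))"
    by (rule smooth_on_linear_arg[OF open_S])
      (auto intro: linear_dd_G smooth_on_dd smooth_G smooth_V)
  then have "smooth_on S (\<lambda>x. dd (\<lambda>y. G y X Y) x (V x) + G x (dd V x X) Y + G x X (dd V x Y))"
    by (intro smooth_on_add open_S smooth_on_G smooth_on_dd smooth_V smooth_on_const)
  then show ?thesis
    by (rule smooth_on_cong[OF open_S, THEN iffD2, rotated]) (rule lie_metric_eq)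
qed

text \<open>Differentiate the compatibility of the connection with the metric along \<open>V\<close>; the second
  derivatives of the metric cancel by Schwarz's theorem.\<close>

lemma covariant_lie_metric:
  assumes x: "x \<in> S"
  shows "dd (\<lambda>y. lie_metric V G y X Y) x z - lie_metric V G x (\<Gamma> x z X) Y - lie_metric V G x X (\<Gamma> x z Y)
    = G x (lie_connection V G (\<lambda>_. z) (\<lambda>_. X) x) Y + G x X (lie_connection V G (\<lambda>_. z) (\<lambda>_. Y) x)"
proof -
  let ?g = "\<lambda>y. G y X Y"
  have sm: "smooth_on S (\<lambda>x. dd ?g x (V x))"
    by (rule smooth_on_linear_arg[OF open_S])
      (auto intro: linear_dd_G smooth_on_dd smooth_G smooth_V)
  note d = smooth_on_differentiable[OF _ open_S x]
  have s1: "smooth_on S (\<lambda>y. G y (dd V y X) Y)" "smooth_on S (\<lambda>y. G y X (dd V y Y))"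
    "smooth_on S (\<lambda>y. G y (\<Gamma> y z X) Y)" "smooth_on S (\<lambda>y. G y X (\<Gamma> y z Y))"
    by (intro smooth_on_G smooth_on_dd smooth_V smooth_on_const smooth_christoffel)+
  have "dd (\<lambda>y. lie_metric V G y X Y) x z
      = dd (\<lambda>y. dd ?g y (V y) + G y (dd V y X) Y + G y X (dd V y Y)) x z"
    by (rule dd_cong[OF open_S x]) (rule lie_metric_eq)
  also have "\<dots> = dd (\<lambda>y. dd ?g y (V y)) x z + dd (\<lambda>y. G y (dd V y X) Y) x z
      + dd (\<lambda>y. G y X (dd V y Y)) x z"
    using dd_add[OF d[OF smooth_on_add[OF open_S sm s1(1)]] d[OF s1(2)], of z]
      dd_add[OF d[OF sm] d[OF s1(1)], of z] by simp
  also have "dd (\<lambda>y. dd ?g y (V y)) x z = dd (\<lambda>y. dd ?g y (V x)) x z + dd ?g x (dd V x z)"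
    by (rule dd_linear_arg[OF open_S x])
      (auto intro: linear_dd_G d smooth_on_dd smooth_G smooth_V)
  also have "dd (\<lambda>y. dd ?g y (V x)) x z = dd (\<lambda>y. dd ?g y z) x (V x)"
    by (rule dd_commute[OF open_S smooth_G x])
  also have "\<dots> = dd (\<lambda>y. G y (\<Gamma> y z X) Y + G y X (\<Gamma> y z Y)) x (V x)"
    by (rule dd_cong[OF open_S x]) (rule metric_compatible)
  also have "\<dots> = dd (\<lambda>y. G y (\<Gamma> y z X) Y) x (V x) + dd (\<lambda>y. G y X (\<Gamma> y z Y)) x (V x)"
    by (intro dd_add d s1)
  finally have "dd (\<lambda>y. lie_metric V G y X Y) x z
      = dd (\<lambda>y. G y (\<Gamma> y z X) Y) x (V x) + dd (\<lambda>y. G y X (\<Gamma> y z Y)) x (V x) + dd ?g x (dd V x z)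
        + dd (\<lambda>y. G y (dd V y X) Y) x z + dd (\<lambda>y. G y X (dd V y Y)) x z" .
  then show ?thesis
    by (simp add: dd_G[OF x] smooth_christoffel smooth_on_dd smooth_V lie_metric_eq[OF x]
        lie_connection_eq[OF x] metric_compatible[OF x] G_simps[OF x]
        bilinear_lzero[OF bilinear_G[OF x]] bilinear_rzero[OF bilinear_G[OF x]])
qed

text \<open>On the diagonal \<open>lie_metric\<close> is twice the inner product of e with the
  covariant derivative of V along e, by metric compatibility and torsion-freeness. This makes the
  divergence a trace to which \<open>dd_frame_trace\<close> applies.\<close>

lemma divergence_eq:
  assumes x: "x \<in> S"
  shows "divergence G V x = (\<Sum>i\<in>UNIV. lie_metric V G x (frame G x i) (frame G x i)) / 2"
proof -
  have "lie_metric V G x e e = 2 * G x (nabla G (\<lambda>_. e) V x) e" for e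
    using christoffel_sym[OF x, of e "V x"]
      G_sym[OF x, of e "dd V x e"] G_sym[OF x, of e "\<Gamma> x (V x) e"]
    by (simp add: lie_metric_eq[OF x] metric_compatible[OF x] nabla_def G_simps[OF x])
  then show ?thesis by (simp add: divergence_def flip: sum_distrib_left)
qed

lemma smooth_divergence: "smooth_on S (divergence G V)"
proof -
  have "smooth_on S (\<lambda>x. (\<Sum>i\<in>UNIV. lie_metric V G x (frame G x i) (frame G x i)) / 2)"
    by (intro smooth_on_divide open_S smooth_frame_trace bilinear_lie_metric smooth_lie_metric) auto
  then show ?thesis
    by (rule smooth_on_cong[OF open_S, THEN iffD2, rotated]) (rule divergence_eq)
qed

context
  fixes \<rho> :: "real ^ 'n \<Rightarrow> real ^ 'n \<Rightarrow> real"
  assumes linear_\<rho>: "x \<in> S \<Longrightarrow> linear (\<rho> x)"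
    and projective: "x \<in> S \<Longrightarrow>
      lie_connection V G (\<lambda>_. X) (\<lambda>_. Y) x = \<rho> x X *\<^sub>R Y + \<rho> x Y *\<^sub>R X"
begin

lemma covariant_lie_metric_projective:
  "x \<in> S \<Longrightarrow>
    dd (\<lambda>y. lie_metric V G y X Y) x z - lie_metric V G x (\<Gamma> x z X) Y - lie_metric V G x X (\<Gamma> x z Y)
      = 2 * \<rho> x z * G x X Y + \<rho> x X * G x z Y + \<rho> x Y * G x X z"
  by (simp add: covariant_lie_metric projective G_simps)

lemma frame_contract_\<rho>: "x \<in> S \<Longrightarrow> (\<Sum>i\<in>UNIV. \<rho> x (frame G x i) * G x z (frame G x i)) = \<rho> x z"
  using frame_contract[of x "\<rho> x" z] linear_\<rho> by (simp add: mult.commute)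

text \<open>The trace of the covariant derivative of \<open>lie_metric\<close> is (2n + 1 + 1)
  \<rho>: the first term contributes the dimension, the other two contract to \<rho>. Halving leaves
  n + 1.\<close>

lemma dd_divergence:
  assumes x: "x \<in> S"
  shows "dd (divergence G V) x z = (real CARD('n) + 1) * \<rho> x z"
proof -
  let ?t = "\<lambda>x. \<Sum>i\<in>UNIV. lie_metric V G x (frame G x i) (frame G x i)"
  have t: "smooth_on S ?t"
    by (intro smooth_frame_trace bilinear_lie_metric smooth_lie_metric)
  have "dd ?t x z = (\<Sum>i\<in>UNIV. 2 * \<rho> x z * G x (frame G x i) (frame G x i)
      + \<rho> x (frame G x i) * G x z (frame G x i) + \<rho> x (frame G x i) * G x (frame G x i) z)"
    by (simp add: dd_frame_trace[OF x bilinear_lie_metric smooth_lie_metric]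
        covariant_lie_metric_projective[OF x])
  also have "\<dots> = 2 * (real CARD('n) + 1) * \<rho> x z"
    using frame_contract_\<rho>[OF x, of z]
    by (simp add: G_sym[OF x, of "frame G x _" z] sum.distrib G_frame[OF x] algebra_simps
        flip: sum_distrib_left)
  finally have "dd ?t x z = 2 * (real CARD('n) + 1) * \<rho> x z" .
  moreover have "dd (divergence G V) x z = dd (\<lambda>y. (1/2) * ?t y) x z"
    by (rule dd_cong[OF open_S x]) (simp add: divergence_eq)
  moreover have "dd (\<lambda>y. (1/2) * ?t y) x z = (1/2) * dd ?t x z"
    by (rule dd_bounded_linear[OF bounded_linear_mult_right smooth_on_differentiable[OF t open_S x]])
  ultimately show ?thesis by (simp add: algebra_simps)
qed

lemma dd_projective_factor: "x \<in> S \<Longrightarrow> dd (projective_factor G V) x z = \<rho> x z"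
  using dd_bounded_linear[OF bounded_linear_divide smooth_on_differentiable[OF smooth_divergence open_S],
      of x "real CARD('n) + 1" z]
  by (simp add: projective_factor_def[abs_def] dd_divergence add_nonneg_eq_0_iff)

lemma smooth_projective_factor: "smooth_on S (projective_factor G V)"
  unfolding projective_factor_def[abs_def]
  by (intro smooth_on_divide open_S smooth_divergence) auto

section \<open>Solitons\<close>

context
  fixes P :: "real ^ 'n \<Rightarrow> real ^ 'n" and l :: "real ^ 'n \<Rightarrow> real" and \<beta> :: real
  assumes smooth_P: "smooth_on S P" and smooth_l: "smooth_on S l"
    and soliton: "x \<in> S \<Longrightarrow>
      lie_metric V G x X Y / 2 + omega_bach G \<beta> (dual_form G P) x X Y = l x * G x X Y"
begin

lemma soliton_trace:
  assumes x: "x \<in> S" and n: "CARD('n) \<ge> 3"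
  shows "divergence G V x = \<beta> * norm_squared G P x + real CARD('n) * l x"
proof -
  let ?e = "frame G x"
  have "(\<Sum>i\<in>UNIV. lie_metric V G x (?e i) (?e i) / 2 + omega_bach G \<beta> (dual_form G P) x (?e i) (?e i))
      = (\<Sum>i\<in>UNIV. l x * G x (?e i) (?e i))"
    by (simp add: soliton[OF x])
  \<comment> \<open>The trace of \<omega> \<otimes> \<omega>, computed by contracting P with
    itself.\<close>
  moreover have "(\<Sum>i\<in>UNIV. G x (?e i) (P x) * G x (?e i) (P x)) = norm_squared G P x"
    using frame_contract[OF x linear_G_right[OF x], of "P x" "P x"]
    by (simp only: G_sym[OF x, of "frame G x _" "P x"] norm_squared_def)
  ultimately show ?thesis
    using trace_bach[OF x n] trace_G[OF x]
    by (simp add: divergence_eq[OF x] omega_bach_def dual_form_def sum.distrib sum_subtractf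
        flip: sum_distrib_left sum_divide_distrib) (simp add: algebra_simps)
qed

lemma smooth_norm_squared: "smooth_on S (norm_squared G P)"
  unfolding norm_squared_def[abs_def] by (intro smooth_on_G smooth_P)

lemma soliton_dd_trace:
  assumes x: "x \<in> S" and n: "CARD('n) \<ge> 3"
  shows "(real CARD('n) + 1) * \<rho> x z = \<beta> * dd (norm_squared G P) x z + real CARD('n) * dd l x z"
proof -
  note d = smooth_on_differentiable[OF _ open_S x]
  have "dd (divergence G V) x z = dd (\<lambda>y. \<beta> * norm_squared G P y + real CARD('n) * l y) x z"
    by (rule dd_cong[OF open_S x]) (rule soliton_trace[OF _ n])
  also have "\<dots> = dd (\<lambda>y. \<beta> * norm_squared G P y) x z + dd (\<lambda>y. real CARD('n) * l y) x z"
    by (intro dd_add d smooth_on_mult open_S smooth_on_const smooth_l smooth_norm_squared)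
  also have "\<dots> = \<beta> * dd (norm_squared G P) x z + real CARD('n) * dd l x z"
    by (simp only: dd_bounded_linear[OF bounded_linear_mult_right d[OF smooth_l]]
        dd_bounded_linear[OF bounded_linear_mult_right d[OF smooth_norm_squared]])
  finally show ?thesis by (simp add: dd_divergence[OF x])
qed

lemma tensor_divergence_omega_bach:
  assumes x: "x \<in> S"
  shows "tensor_divergence G (omega_bach G \<beta> (dual_form G P)) x Z
    = dd l x Z - (real CARD('n) + 3) / 2 * \<rho> x Z"
proof -
  let ?B = "omega_bach G \<beta> (dual_form G P)" and ?h = "lie_metric V G"
  note d = smooth_on_differentiable[OF _ open_S x]
  have B: "?B y X Y = l y * G y X Y - (1/2) * ?h y X Y" if "y \<in> S" for y X Y
    using soliton[OF that, of X Y] by simp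
  \<comment> \<open>The soliton equation holds throughout S and may be differentiated. Compatibility
    removes the derivative of g, so \<lambda> g contributes only d\<lambda> times g.\<close>
  have dB: "dd (\<lambda>y. ?B y X Y) x z - ?B x (\<Gamma> x z X) Y - ?B x X (\<Gamma> x z Y)
      = dd l x z * G x X Y - (1/2) * (2 * \<rho> x z * G x X Y + \<rho> x X * G x z Y + \<rho> x Y * G x X z)" for X Y z
  proof -
    have "dd (\<lambda>y. ?B y X Y) x z = dd (\<lambda>y. l y * G y X Y - (1/2) * ?h y X Y) x z"
      by (rule dd_cong[OF open_S x]) (rule B)
    also have "\<dots> = dd (\<lambda>y. l y * G y X Y) x z - dd (\<lambda>y. (1/2) * ?h y X Y) x z"
      by (intro dd_diff d smooth_on_mult open_S smooth_l smooth_G smooth_lie_metric smooth_on_const)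
    also have "dd (\<lambda>y. l y * G y X Y) x z = l x * dd (\<lambda>y. G y X Y) x z + dd l x z * G x X Y"
      by (intro dd_mult d smooth_l smooth_G)
    also have "dd (\<lambda>y. (1/2) * ?h y X Y) x z = (1/2) * dd (\<lambda>y. ?h y X Y) x z"
      by (rule dd_bounded_linear[OF bounded_linear_mult_right d[OF smooth_lie_metric]])
    finally show ?thesis
      unfolding covariant_lie_metric_projective[OF x, symmetric] B[OF x]
      by (simp add: metric_compatible[OF x] algebra_simps)
  qed
  have covd: "covd G (\<lambda>y ws. ?B y (ws ! 0) (ws ! 1)) x [z, X, Y]
      = dd (\<lambda>y. ?B y X Y) x z - ?B x (\<Gamma> x z X) Y - ?B x X (\<Gamma> x z Y)" for z X Y
    by (simp add: covd_def lessThan_Suc)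
  \<comment> \<open>With the direction equal to the first argument, two of the three \<rho>-terms
    coincide up to the factors 2 and 1, hence the 3; the last one carries the trace of g, so the
    total is n + 3.\<close>
  have "tensor_divergence G ?B x Z
      = (\<Sum>i\<in>UNIV. dd l x (frame G x i) * G x Z (frame G x i)
          - (1/2) * (3 * (\<rho> x (frame G x i) * G x Z (frame G x i)) + \<rho> x Z * G x (frame G x i) (frame G x i)))"
    unfolding tensor_divergence_def covd dB
    by (intro sum.cong refl) (simp add: G_sym[OF x, of "frame G x _" Z])
  also have "\<dots> = (\<Sum>i\<in>UNIV. dd l x (frame G x i) * G x Z (frame G x i))
      - (1/2) * (3 * (\<Sum>i\<in>UNIV. \<rho> x (frame G x i) * G x Z (frame G x i))
          + \<rho> x Z * (\<Sum>i\<in>UNIV. G x (frame G x i) (frame G x i)))"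
    by (simp only: distrib_left sum.distrib sum_subtractf sum_distrib_left)
  also have "(\<Sum>i\<in>UNIV. dd l x (frame G x i) * G x Z (frame G x i)) = dd l x Z"
    using frame_contract[OF x linear_dd[OF d[OF smooth_l]], of Z] by (simp add: mult.commute)
  finally show ?thesis
    by (simp add: frame_contract_\<rho>[OF x] trace_G[OF x] algebra_simps add_divide_distrib)
qed

end

end

end

lemma G_gradient:
  assumes "x \<in> S" "f differentiable at x"
  shows "G x (gradient G f x) z = dd f x z"
  using theI'[OF inner_form_representation[OF inner_form_G linear_dd, OF assms]]
  unfolding gradient_def by blast

text \<open>Nondegeneracy of the metric turns the gradient equation into one between differentials,
  the form in which the trace and divergence identities are available.\<close>

lemma gradient_eq_scaleR_iff:
  assumes x: "x \<in> S" and f: "f differentiable at x" and k: "k differentiable at x"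
  shows "gradient G f x = c *\<^sub>R gradient G k x \<longleftrightarrow> (\<forall>z. dd f x z = c * dd k x z)"
proof
  assume "gradient G f x = c *\<^sub>R gradient G k x"
  then have "G x (gradient G f x) z = G x (c *\<^sub>R gradient G k x) z" for z by simp
  then show "\<forall>z. dd f x z = c * dd k x z"
    by (simp add: G_simps[OF x] G_gradient[OF x] f k)
next
  assume "\<forall>z. dd f x z = c * dd k x z"
  then show "gradient G f x = c *\<^sub>R gradient G k x"
    by (intro G_eqI[OF x]) (simp add: G_simps[OF x] G_gradient[OF x] f k)
qed

end

text \<open>Here r, d and q stand for the differentials of \<phi>, \<lambda> and |P|^2 at one
  vector. Multiplying the divergence by n allows n d to be replaced through the trace equation. The
  determinant n^2 + n - 2 = (n - 1)(n + 2) is positive, so the equivalence can be solved for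
  r.\<close>

lemma soliton_linear_system:
  fixes n r d q \<beta> :: real
  assumes n: "n \<ge> 3" and trace: "(n + 1) * r = \<beta> * q + n * d"
  shows "d - (n + 3) / 2 * r = 0 \<longleftrightarrow> r = - (2 * \<beta> / (n^2 + n - 2)) * q"
    and "d - (n + 3) / 2 * r = 0 \<Longrightarrow> d = - ((n + 3) / (n^2 + n - 2)) * \<beta> * q"
proof -
  have pos: "n^2 + n - 2 > 0" using n by (smt (verit) zero_le_power2)
  have "n * (d - (n + 3) / 2 * r) = - ((n^2 + n - 2) * r + 2 * \<beta> * q) / 2"
    using trace by (simp add: power2_eq_square field_simps)
  moreover have "a = 0 \<longleftrightarrow> e = 0" if "a = - e / 2" for a e :: real
    using that by auto
  ultimately have "n * (d - (n + 3) / 2 * r) = 0 \<longleftrightarrow> (n^2 + n - 2) * r + 2 * \<beta> * q = 0"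
    by blast
  moreover have "d - (n + 3) / 2 * r = 0 \<longleftrightarrow> n * (d - (n + 3) / 2 * r) = 0"
    using n by (simp only: mult_eq_0_iff) auto
  ultimately have "d - (n + 3) / 2 * r = 0 \<longleftrightarrow> (n^2 + n - 2) * r + 2 * \<beta> * q = 0"
    by (simp only:)
  also have "\<dots> \<longleftrightarrow> r = - (2 * \<beta> / (n^2 + n - 2)) * q"
    using pos by (auto simp: field_simps)
  finally show 1: "d - (n + 3) / 2 * r = 0 \<longleftrightarrow> r = - (2 * \<beta> / (n^2 + n - 2)) * q" .
  show "d = - ((n + 3) / (n^2 + n - 2)) * \<beta> * q" if "d - (n + 3) / 2 * r = 0"
  proof -
    have "d = (n + 3) / 2 * r" using that by simp
    also have "\<dots> = (n + 3) / 2 * (- (2 * \<beta> / (n^2 + n - 2)) * q)" using iffD1[OF 1 that] by (simp only:)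
    finally show ?thesis by simp
  qed
qed

theorem theorem3p5:
  fixes A :: "('a::{t2_space, second_countable_topology}, 'n::finite) chart set"
    and g :: "('a, 'n) chart \<Rightarrow> 'n metric"
    and V P :: "('a, 'n) chart \<Rightarrow> real ^ 'n \<Rightarrow> real ^ 'n"
    and \<omega> :: "('a, 'n) chart \<Rightarrow> real ^ 'n \<Rightarrow> real ^ 'n \<Rightarrow> real"
    and lam :: "'a \<Rightarrow> real"
    and \<beta> n :: real
  assumes n_def: "n = real CARD('n)"
    and dim: "CARD('n) \<ge> 4"
    and P: "vector_field A P"
    and \<omega>_def: "\<omega> = (\<lambda>c. dual_form (g c) (P c))"
    and soliton: "almost_omega_bach_soliton A g V lam \<beta> \<omega>"
    and projective: "projective_vector_field A g V"
  shows "((\<forall>c\<in>A. \<forall>x\<in>cimg c. \<forall>Z. tensor_divergence (g c) (omega_bach (g c) \<beta> (\<omega> c)) x Z = 0)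
          \<longleftrightarrow>
          (\<forall>c\<in>A. \<forall>x\<in>cimg c. gradient (g c) (projective_factor (g c) (V c)) x =
             - (2 * \<beta> / (n^2 + n - 2)) *\<^sub>R gradient (g c) (norm_squared (g c) (P c)) x))
       \<and>
         ((\<forall>c\<in>A. \<forall>x\<in>cimg c. \<forall>Z. tensor_divergence (g c) (omega_bach (g c) \<beta> (\<omega> c)) x Z = 0)
          \<longrightarrow>
          (\<forall>X. vector_field A X \<longrightarrow>
             (\<forall>c\<in>A. \<forall>x\<in>cimg c. dd (lam \<circ> cinv c) x (X c x) =
                - ((n + 3) / (n^2 + n - 2)) * \<beta> * dd (norm_squared (g c) (P c)) x (X c x))))"
proof -
  obtain \<rho> where "one_form A \<rho>"
    and lie: "\<And>c X Y x. c \<in> A \<Longrightarrow> smooth_on (cimg c) X \<Longrightarrow> smooth_on (cimg c) Y \<Longrightarrow> x \<in> cimg c \<Longrightarrow>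
      lie_connection (V c) (g c) X Y x = \<rho> c x (X x) *\<^sub>R Y x + \<rho> c x (Y x) *\<^sub>R X x"
    using projective unfolding projective_vector_field_def by blast
  note defs = almost_omega_bach_soliton_def smooth_atlas_def riemannian_metric_def vector_field_def
    smooth_function_def one_form_def
  \<comment> \<open>Both claims hold point by point, the second even for each single vector Z; the
    quantifiers over charts, points and fields are restored only at the end.\<close>
  have pointwise: "(\<forall>Z. tensor_divergence (g c) (omega_bach (g c) \<beta> (\<omega> c)) x Z = 0) \<longleftrightarrow>
        gradient (g c) (projective_factor (g c) (V c)) x =
          - (2 * \<beta> / (n^2 + n - 2)) *\<^sub>R gradient (g c) (norm_squared (g c) (P c)) x"
    "tensor_divergence (g c) (omega_bach (g c) \<beta> (\<omega> c)) x Z = 0 \<Longrightarrow>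
        dd (lam \<circ> cinv c) x Z = - ((n + 3) / (n^2 + n - 2)) * \<beta> * dd (norm_squared (g c) (P c)) x Z"
    if c: "c \<in> A" and x: "x \<in> cimg c" for c x Z
  proof -
    interpret chart_metric "cimg c" "g c"
      using soliton c by unfold_locales (auto simp: defs)
    have V: "smooth_on (cimg c) (V c)" and Pc: "smooth_on (cimg c) (P c)"
      and l: "smooth_on (cimg c) (lam \<circ> cinv c)"
      and \<rho>: "\<And>x. x \<in> cimg c \<Longrightarrow> linear (\<rho> c x)"
      and eq: "\<And>x X Y. x \<in> cimg c \<Longrightarrow> lie_metric (V c) (g c) x X Y / 2
        + omega_bach (g c) \<beta> (dual_form (g c) (P c)) x X Y = (lam \<circ> cinv c) x * g c x X Y"
      using soliton P \<open>one_form A \<rho>\<close> c by (auto simp: defs \<omega>_def)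
    have pr: "\<And>x X Y. x \<in> cimg c \<Longrightarrow> lie_connection (V c) (g c) (\<lambda>_. X) (\<lambda>_. Y) x
        = \<rho> c x X *\<^sub>R Y + \<rho> c x Y *\<^sub>R X"
      using lie[OF c] by simp
    have n: "n \<ge> 3" and card: "CARD('n) \<ge> 3" using dim n_def by simp_all
    \<comment> \<open>The trace identity is available for every vector, so this linear system
      applies to each Z separately.\<close>
    note system = soliton_linear_system[OF n soliton_dd_trace[OF V \<rho> pr Pc l eq x card, folded n_def]]
    have div: "tensor_divergence (g c) (omega_bach (g c) \<beta> (\<omega> c)) x Z
        = dd (lam \<circ> cinv c) x Z - (n + 3) / 2 * \<rho> c x Z" for Z
      unfolding n_def \<omega>_def by (rule tensor_divergence_omega_bach[OF V \<rho> pr Pc l eq x])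
    show "(\<forall>Z. tensor_divergence (g c) (omega_bach (g c) \<beta> (\<omega> c)) x Z = 0) \<longleftrightarrow>
        gradient (g c) (projective_factor (g c) (V c)) x =
          - (2 * \<beta> / (n^2 + n - 2)) *\<^sub>R gradient (g c) (norm_squared (g c) (P c)) x"
      by (simp only: div system(1) dd_projective_factor[OF V \<rho> pr x]
          gradient_eq_scaleR_iff[OF x
            smooth_on_differentiable[OF smooth_projective_factor[OF V \<rho> pr] open_S x]
            smooth_on_differentiable[OF smooth_norm_squared[OF V \<rho> pr Pc l eq] open_S x]])
    show "dd (lam \<circ> cinv c) x Z = - ((n + 3) / (n^2 + n - 2)) * \<beta> * dd (norm_squared (g c) (P c)) x Z"
      if "tensor_divergence (g c) (omega_bach (g c) \<beta> (\<omega> c)) x Z = 0"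
      using that unfolding div by - (rule system(2))
  qed
  then show ?thesis by blast
qed

end
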